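(* Let $\underline u^0\in \mathbb H^1_e(\mathcal T)$. Then there exists a unique solution $\underline u=(u_1,\dots,u_N)\in C([0,\infty),\mathbb H^1_e(\mathcal T))$ of the Benjamin-Bona-Mahony system on the star-shaped network $$ \left\{\begin{array}{l} (\partial_t u_j-\partial_x^2\partial_t u_j+\partial_x u_j+u_j\partial_x u_j)(t,x)=0,\quad x\in(0,\ell_j),\ t>0,\ j=1,\dots,N,\\ u_j(t,0)=u_k(t,0),\quad t>0,\ j,k=1,\dots,N,\\ \sum_{j=1}^N\partial_x\partial_t u_j(t,0)=\alpha\,u_1(t,0)+\frac N3 u_1^2(t,0),\quad t>0,\\ u_j(t,\ell_j)=0,\quad t>0,\ j=1,\dots,N,\\ u_j(0,x)=u_j^0(x),\quad x\in(0,\ell_j),\ j=1,\dots,N. \end{array}\right. $$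
   Context: $N\ge 1$ is an integer (number of edges), $\ell_1,\dots,\ell_N>0$ are the edge lengths, the edges are identified with the intervals $(0,\ell_j)$, all glued at the central node $x=0$, and $\mathcal T$ denotes the resulting star-shaped network. The constant $\alpha$ satisfies $\alpha>N/2$. Functions are real-valued. $\mathbb H^1_e(\mathcal T)=\{\underline u=(u_1,\dots,u_N)\in\bigoplus_{j=1}^N H^1(0,\ell_j):\ u_j(\ell_j)=0,\ u_j(0)=u_k(0)\ \forall j,k=1,\dots,N\}$, with inner product $\langle\underline u,\underline v\rangle=\sum_{j=1}^N\int_0^{\ell_j}(u_j\overline{v_j}+u_j'\overline{v_j'})\,dx$. Solutions are understood in integral form: $\underline u(t)=\underline u^0+\int_0^t\underline v(\tau)\,d\tau$ for all $t\geq 0$, where for each $\tau$, $\underline v(\tau)=\underline v\in\bigoplus_{j}H^2(0,\ell_j)$ is the unique solution of the elliptic problem $(1-\partial_x^2)v_j=-\partial_x u_j(\tau)-u_j(\tau)\partial_x u_j(\tau)$ on $(0,\ell_j)$, $v_j(0)=v_k(0)$ for all $j,k$, $\sum_{j=1}^N\partial_x v_j(0)=\alpha u_1(\tau,0)+\frac N3u_1^2(\tau,0)$, $v_j(\ell_j)=0$ for all $j$. *)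

theory Defs
  imports "HOL-Analysis.Analysis"
begin

section \<open>Sobolev spaces on an interval (0, L)\<close>

definition L2 :: "real \<Rightarrow> (real \<Rightarrow> real) set" where
  "L2 L = {f. f \<in> borel_measurable (lebesgue_on {0<..<L}) \<and>
              integrable (lebesgue_on {0<..<L}) (\<lambda>x. (f x)\<^sup>2)}"

text \<open>Weak derivative, tested against compactly supported C1 functions on (0, L) (the usual
  one-dimensional convention), which are represented by their extension by zero to the real line.\<close>

definition weak_deriv :: "real \<Rightarrow> (real \<Rightarrow> real) \<Rightarrow> (real \<Rightarrow> real) \<Rightarrow> bool" where
  "weak_deriv L u g \<longleftrightarrow>
     (\<forall>\<phi> \<phi>'. (\<forall>x. (\<phi> has_real_derivative \<phi>' x) (at x)) \<and> continuous_on UNIV \<phi>' \<and>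
             (\<exists>K. compact K \<and> K \<subseteq> {0<..<L} \<and> (\<forall>x. x \<notin> K \<longrightarrow> \<phi> x = 0)) \<longrightarrow>
        (LINT x|lebesgue_on {0<..<L}. u x * \<phi>' x) = - (LINT x|lebesgue_on {0<..<L}. g x * \<phi> x))"

text \<open>Elements of H1 are represented by functions that agree on the closed interval with the
  continuous representative, so that boundary values are literal function values. Values outside
  the closed interval are irrelevant.\<close>

definition H1 :: "real \<Rightarrow> (real \<Rightarrow> real) set" where
  "H1 L = {u. continuous_on {0..L} u \<and> u \<in> L2 L \<and> (\<exists>g \<in> L2 L. weak_deriv L u g)}"

text \<open>A representative of the weak derivative, determined only almost everywhere on (0, L).\<close>

definition wderiv :: "real \<Rightarrow> (real \<Rightarrow> real) \<Rightarrow> real \<Rightarrow> real" where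
  "wderiv L u = (SOME g. g \<in> L2 L \<and> weak_deriv L u g)"

definition H2 :: "real \<Rightarrow> (real \<Rightarrow> real) set" where
  "H2 L = {u \<in> H1 L. \<exists>p \<in> H1 L. weak_deriv L u p}"

text \<open>For \<open>u\<close> in H2, the continuous representative of the weak derivative; it is determined
  everywhere on the closed interval, and in particular has a value at the node 0.\<close>

definition cderiv :: "real \<Rightarrow> (real \<Rightarrow> real) \<Rightarrow> real \<Rightarrow> real" where
  "cderiv L u = (SOME p. p \<in> H1 L \<and> weak_deriv L u p)"


section \<open>Functions on the star-shaped network\<close>

text \<open>A function on the network with edge lengths \<open>l 1, \<dots>, l N\<close> is a family \<open>u j x\<close>, of which
  only the values for \<open>j \<in> {1..N}\<close> and \<open>x \<in> {0..l j}\<close> matter.\<close>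

type_synonym net_fun = "nat \<Rightarrow> real \<Rightarrow> real"

definition net_eq :: "nat \<Rightarrow> (nat \<Rightarrow> real) \<Rightarrow> net_fun \<Rightarrow> net_fun \<Rightarrow> bool" where
  "net_eq N l u v \<longleftrightarrow> (\<forall>j\<in>{1..N}. \<forall>x\<in>{0..l j}. u j x = v j x)"

definition H1e :: "nat \<Rightarrow> (nat \<Rightarrow> real) \<Rightarrow> net_fun set" where
  "H1e N l = {u. (\<forall>j\<in>{1..N}. u j \<in> H1 (l j)) \<and> (\<forall>j\<in>{1..N}. u j (l j) = 0) \<and>
                 (\<forall>j\<in>{1..N}. \<forall>k\<in>{1..N}. u j 0 = u k 0)}"

definition H1e_inner :: "nat \<Rightarrow> (nat \<Rightarrow> real) \<Rightarrow> net_fun \<Rightarrow> net_fun \<Rightarrow> real" where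
  "H1e_inner N l u v = (\<Sum>j=1..N. LINT x|lebesgue_on {0<..<l j}.
      u j x * v j x + wderiv (l j) (u j) x * wderiv (l j) (v j) x)"

definition H1e_norm :: "nat \<Rightarrow> (nat \<Rightarrow> real) \<Rightarrow> net_fun \<Rightarrow> real" where
  "H1e_norm N l u = sqrt (H1e_inner N l u u)"

text \<open>The space of continuous curves from the half line t >= 0 into \<open>H1e\<close>, with its norm
  topology; values at negative times are irrelevant.\<close>

definition C_H1e :: "nat \<Rightarrow> (nat \<Rightarrow> real) \<Rightarrow> (real \<Rightarrow> net_fun) set" where
  "C_H1e N l = {u. (\<forall>t\<ge>0. u t \<in> H1e N l) \<and>
     (\<forall>t\<ge>0. ((\<lambda>s. H1e_norm N l (\<lambda>j x. u s j x - u t j x)) \<longlongrightarrow> 0) (at t within {0..}))}"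

text \<open>\<open>w\<close> is the \<open>H1e\<close>-valued integral of \<open>v\<close> over [0, t]: this is the definition of
  \<open>has_integral\<close> with the norm of \<open>H1e\<close> in place of the norm of a type. On continuous curves it is
  the Riemann (and the Bochner) integral.\<close>

definition has_integral_H1e ::
  "nat \<Rightarrow> (nat \<Rightarrow> real) \<Rightarrow> (real \<Rightarrow> net_fun) \<Rightarrow> net_fun \<Rightarrow> real \<Rightarrow> bool" where
  "has_integral_H1e N l v w t \<longleftrightarrow>
     (\<forall>\<tau>\<in>{0..t}. v \<tau> \<in> H1e N l) \<and> w \<in> H1e N l \<and>
     (\<forall>e>0. \<exists>\<gamma>. gauge \<gamma> \<and>
        (\<forall>D. D tagged_division_of {0..t} \<and> \<gamma> fine D \<longrightarrow>
           H1e_norm N l (\<lambda>j x. (\<Sum>(\<tau>, K)\<in>D. measure lborel K * v \<tau> j x) - w j x) < e))"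


section \<open>The Benjamin-Bona-Mahony system\<close>

definition elliptic_solution ::
  "nat \<Rightarrow> (nat \<Rightarrow> real) \<Rightarrow> real \<Rightarrow> net_fun \<Rightarrow> net_fun \<Rightarrow> bool" where
  "elliptic_solution N l \<alpha> u v \<longleftrightarrow>
     (\<forall>j\<in>{1..N}. v j \<in> H2 (l j)) \<and>
     (\<forall>j\<in>{1..N}. AE x in lebesgue_on {0<..<l j}.
        v j x - wderiv (l j) (cderiv (l j) (v j)) x
          = - wderiv (l j) (u j) x - u j x * wderiv (l j) (u j) x) \<and>
     (\<forall>j\<in>{1..N}. \<forall>k\<in>{1..N}. v j 0 = v k 0) \<and>
     (\<Sum>j=1..N. cderiv (l j) (v j) 0) = \<alpha> * u 1 0 + real N / 3 * (u 1 0)\<^sup>2 \<and>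
     (\<forall>j\<in>{1..N}. v j (l j) = 0)"

definition unique_elliptic_solution ::
  "nat \<Rightarrow> (nat \<Rightarrow> real) \<Rightarrow> real \<Rightarrow> net_fun \<Rightarrow> net_fun \<Rightarrow> bool" where
  "unique_elliptic_solution N l \<alpha> u v \<longleftrightarrow>
     elliptic_solution N l \<alpha> u v \<and> (\<forall>w. elliptic_solution N l \<alpha> u w \<longrightarrow> net_eq N l w v)"

text \<open>Solutions in integral form: \<open>u t = u0 + \<integral>v \<tau> d\<tau>\<close> over [0, t], where \<open>v \<tau>\<close> (the time derivative
  of \<open>u\<close>) is the solution of the elliptic problem with data \<open>u \<tau>\<close>.\<close>

definition BBM_solution ::
  "nat \<Rightarrow> (nat \<Rightarrow> real) \<Rightarrow> real \<Rightarrow> net_fun \<Rightarrow> (real \<Rightarrow> net_fun) \<Rightarrow> bool" where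
  "BBM_solution N l \<alpha> u0 u \<longleftrightarrow>
     u \<in> C_H1e N l \<and>
     (\<exists>v. (\<forall>\<tau>\<ge>0. unique_elliptic_solution N l \<alpha> (u \<tau>) (v \<tau>)) \<and>
          (\<forall>t\<ge>0. has_integral_H1e N l v (\<lambda>j x. u t j x - u0 j x) t))"

end

theory Submission
  imports Defs
begin

text \<open>
  With \<open>p = u + u\<^sup>2/2\<close> the elliptic problem for \<open>v = \<partial>\<^sub>t u\<close> reads \<open>v - v'' = - p'\<close>. In terms of the flux
  \<open>w = v' - p\<close> it becomes the system \<open>v' = w + p\<close>, \<open>w' = v\<close>, which contains no derivative of \<open>u\<close>.
  Hence \<open>v'\<close>, and not only \<open>v\<close>, is determined by the values of \<open>u\<close>, and it depends on them in a
  locally Lipschitz way in the supremum norm. The BBM system on the network is therefore an ordinary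
  differential equation in a Banach space. The unknown is the derivative \<open>G(t)\<close> of the increment
  \<open>u(t) - u\<^sub>0\<close>, a continuous function on the network, from which \<open>u(t) = u\<^sub>0 + prim (G(t))\<close> is
  recovered by integration from the outer ends; the rough datum \<open>u\<^sub>0\<close> enters as a constant.

  Existence. Truncating \<open>u\<close> at height \<open>R\<close> inside the nonlinearity makes the equation globally
  Lipschitz (\<open>rhs_Lipschitz\<close>), and a contraction in an exponentially weighted norm gives a solution
  for all times (\<open>global_solution_of_Lipschitz_ODE\<close>). Testing the elliptic problem with \<open>u\<close> itself
  yields \<open>\<langle>u, v\<rangle> = (N/2 - \<alpha>) u(0)\<^sup>2\<close> (\<open>elliptic_energy_identity\<close>), so that the energy \<open>\<parallel>u(t)\<parallel>\<^sup>2\<close> does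
  not grow as long as the truncation is inactive. The supremum norm is bounded by the norm of \<open>H1e\<close>
  (\<open>abs_le_H1e_norm\<close>); with \<open>R > \<parallel>u\<^sub>0\<parallel>\<close> the solution never reaches the truncation
  (\<open>nonincreasing_below_barrier\<close>), and it solves the original system.

  Uniqueness. An energy argument shows that the elliptic problem has at most one solution
  (\<open>elliptic_solution_unique\<close>), so the time derivative of any BBM solution is the one constructed
  explicitly. Evaluated at points of the network, the integral equations of two solutions give an
  integral inequality for their distance in the supremum norm, and Gronwall's lemma applies.

  The Sobolev spaces are treated through primitives. A continuous function has the
  integrable weak derivative \<open>g\<close> exactly if it is, up to a constant, an indefinite integral of \<open>g\<close>
  (\<open>primitive_imp_weak_deriv\<close>, \<open>weak_deriv_imp_primitive\<close>), and every integration by parts is an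
  instance of the product rule \<open>primitive_mult\<close>.
\<close>

section \<open>Primitives of integrable functions\<close>

lemma integrable_open_interval_iff:
  fixes f :: "real \<Rightarrow> real"
  shows "integrable (lebesgue_on {0<..<L}) f \<longleftrightarrow> f absolutely_integrable_on {0..L}"
proof -
  have "integrable (lebesgue_on {0<..<L}) f \<longleftrightarrow> f absolutely_integrable_on {0<..<L}"
    unfolding set_integrable_def by (subst integrable_restrict_space) auto
  also have "\<dots> \<longleftrightarrow> f absolutely_integrable_on {0..L}"
    using absolutely_integrable_on_open_interval[of 0 L f] by simp
  finally show ?thesis .
qed

lemma integrable_closed_interval_iff:
  fixes f :: "real \<Rightarrow> real"
  shows "integrable (lebesgue_on {a..b}) f \<longleftrightarrow> f absolutely_integrable_on {a..b}"
  unfolding set_integrable_def by (subst integrable_restrict_space) auto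

lemma LINT_open_interval_eq:
  fixes f :: "real \<Rightarrow> real"
  assumes "f absolutely_integrable_on {0..L}"
  shows "(LINT x|lebesgue_on {0<..<L}. f x) = integral {0..L} f"
proof -
  have "(LINT x|lebesgue_on {0<..<L}. f x) = integral {0<..<L} f"
    using assms by (intro lebesgue_integral_eq_integral) (auto simp: integrable_open_interval_iff)
  also have "\<dots> = integral {0..L} f"
    by (rule integral_open_interval_real[symmetric])
  finally show ?thesis .
qed

text \<open>Integration by parts for indefinite integrals of integrable functions. By Fubini the two
  summands on the left are the integrals of \<open>f s * g t\<close> over the two triangles into which the
  diagonal cuts the square; the diagonal itself is a null set.\<close>

lemma integral_mult_integral_triangle:
  fixes f g :: "real \<Rightarrow> real"
  assumes f: "f absolutely_integrable_on {0..x}" and g: "g absolutely_integrable_on {0..x}"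
  shows "integral {0..x} (\<lambda>t. f t * integral {0..t} g + integral {0..t} f * g t)
       = integral {0..x} f * integral {0..x} g" (is "?A = ?B")
proof -
  define M where "M = lebesgue_on {0..x}"
  have fin: "finite_measure M"
    unfolding M_def by (intro finite_measure_lebesgue_on) auto
  interpret M: finite_measure M by (rule fin)
  interpret P: pair_sigma_finite M M ..
  have fM: "integrable M f" and gM: "integrable M g"
    using f g by (simp_all add: M_def integrable_closed_interval_iff)
  note [measurable] = borel_measurable_integrable[OF fM] borel_measurable_integrable[OF gM]
  have id[measurable]: "(\<lambda>t. t) \<in> borel_measurable M"
    unfolding M_def by (intro measurable_restrict_space1) (auto intro: measurable_completion)
  have intk: "integrable (M \<Otimes>\<^sub>M M) (\<lambda>(s, t). (if R s t then 1 else 0) * (p s * q t))"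
    if R[measurable]: "Measurable.pred (M \<Otimes>\<^sub>M M) (\<lambda>(s, t). R s t)"
      and p: "integrable M p" and q: "integrable M q" for R and p q :: "real \<Rightarrow> real"
  proof (rule Bochner_Integration.integrable_bound)
    note [measurable] = borel_measurable_integrable[OF p] borel_measurable_integrable[OF q]
    show "integrable (M \<Otimes>\<^sub>M M) (\<lambda>(s, t). p s * q t)"
    proof (rule P.Fubini_integrable)
      show "integrable M (\<lambda>s. LINT t|M. norm (case (s, t) of (s, t) \<Rightarrow> p s * q t))"
        using p by (auto simp: abs_mult)
      show "AE s in M. integrable M (\<lambda>t. case (s, t) of (s, t) \<Rightarrow> p s * q t)"
        using q by auto
    qed auto
    show "(\<lambda>(s, t). (if R s t then 1 else 0) * (p s * q t)) \<in> borel_measurable (M \<Otimes>\<^sub>M M)"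
      by measurable
  qed (auto simp: abs_mult)
  have upto: "(LINT s|M. (if s \<le> t then 1 else 0) * p s) = integral {0..t} p"
    if "t \<in> {0..x}" and p: "integrable M p" for t and p :: "real \<Rightarrow> real"
  proof -
    note [measurable] = borel_measurable_integrable[OF p]
    have "integrable M (\<lambda>s. (if s \<le> t then 1 else 0) * p s)"
      by (rule Bochner_Integration.integrable_bound[OF p]) auto
    then have "(LINT s|M. (if s \<le> t then 1 else 0) * p s)
        = integral {0..x} (\<lambda>s. (if s \<le> t then 1 else 0) * p s)"
      unfolding M_def by (intro lebesgue_integral_eq_integral) auto
    also have "\<dots> = integral {0..x} (\<lambda>s. if s \<in> {0..t} then p s else 0)"
      by (intro integral_cong) auto
    also have "\<dots> = integral {0..t} p"
      using that(1) by (subst integral_restrict_Int) (simp add: Int_absorb2)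
    finally show ?thesis .
  qed
  let ?h = "\<lambda>s t. (if s \<le> t then 1 else 0) * (f s * g t)"
  let ?k = "\<lambda>s t. (if s \<le> t then 1 else 0) * (g s * f t)"
  let ?k' = "\<lambda>s t. (if t \<le> s then 1 else 0) * (f s * g t)"
  have h: "integrable (M \<Otimes>\<^sub>M M) (case_prod ?h)" and k: "integrable (M \<Otimes>\<^sub>M M) (case_prod ?k)"
    and k': "integrable (M \<Otimes>\<^sub>M M) (case_prod ?k')"
    by (intro intk fM gM; measurable)+
  have hk_cong: "(LINT s|M. ?h s t) = integral {0..t} f * g t"
       "(LINT s|M. ?k s t) = f t * integral {0..t} g" if "t \<in> {0..x}" for t
    using upto[OF that fM] upto[OF that gM]
    by (simp_all add: mult.assoc[symmetric] mult.commute[of "f t"])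
  have ih: "integrable M (\<lambda>t. LINT s|M. ?h s t)" and ik: "integrable M (\<lambda>t. LINT s|M. ?k s t)"
    using P.integrable_snd[OF h] P.integrable_snd[OF k] by auto
  have "?A = integral {0..x} (\<lambda>t. (LINT s|M. ?k s t) + (LINT s|M. ?h s t))"
    by (intro integral_cong) (simp add: hk_cong)
  also have "\<dots> = (LINT t|M. (LINT s|M. ?k s t) + (LINT s|M. ?h s t))"
    using ih ik unfolding M_def by (intro lebesgue_integral_eq_integral[symmetric]) auto
  also have "\<dots> = (LINT t|M. (LINT s|M. ?k s t)) + (LINT t|M. (LINT s|M. ?h s t))"
    using ih ik by (intro Bochner_Integration.integral_add)
  \<comment> \<open>Exchange the order of integration over one triangle, then rename the two variables.\<close>
  also have "(LINT t|M. (LINT s|M. ?k s t)) = (LINT s|M. (LINT t|M. ?k s t))"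
    by (rule P.Fubini_integral[OF k])
  also have "\<dots> = (LINT t|M. (LINT s|M. ?k' s t))"
    by (simp add: mult.commute mult.left_commute)
  also have "\<dots> + (LINT t|M. (LINT s|M. ?h s t))
       = (LINT t|M. (LINT s|M. ?k' s t) + (LINT s|M. ?h s t))"
    using P.integrable_snd[OF k'] ih by (intro Bochner_Integration.integral_add[symmetric]) auto
  also have "\<dots> = (LINT t|M. (LINT s|M. f s) * g t)"
  proof (rule Bochner_Integration.integral_cong_AE)
    show "AE t in M. (LINT s|M. ?k' s t) + (LINT s|M. ?h s t) = (LINT s|M. f s) * g t"
    proof (rule AE_I2)
      fix t assume "t \<in> space M"
      have i: "integrable M (\<lambda>s. ?k' s t)" "integrable M (\<lambda>s. ?h s t)"
        by (rule Bochner_Integration.integrable_bound[of M "\<lambda>s. f s * g t"]; use fM in \<open>auto\<close>)+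
      have "AE s in M. s \<noteq> t"
        unfolding M_def by (subst AE_restrict_space_iff) (auto intro!: AE_I'[of "{t}"] simp: null_sets_def)
      then have "AE s in M. ?k' s t + ?h s t = f s * g t" by eventually_elim auto
      then have "(LINT s|M. ?k' s t + ?h s t) = (LINT s|M. f s * g t)"
        by (rule Bochner_Integration.integral_cong_AE[rotated 2]) auto
      with i show "(LINT s|M. ?k' s t) + (LINT s|M. ?h s t) = (LINT s|M. f s) * g t"
        by (simp add: Bochner_Integration.integral_add)
    qed
  qed measurable
  also have "\<dots> = (LINT s|M. f s) * (LINT t|M. g t)" by simp
  also have "\<dots> = ?B"
    using fM gM unfolding M_def by (simp add: lebesgue_integral_eq_integral)
  finally show ?thesis .
qed

text \<open>The integral of \<open>g\<close> vanishes over every subinterval, so Henstock's lemma makes the Riemann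
  sums of \<open>\<bar>g\<bar>\<close>, and not only those of \<open>g\<close>, arbitrarily small.\<close>

lemma integral_Icc_zero_imp_AE_zero:
  fixes g :: "real \<Rightarrow> real"
  assumes g: "g absolutely_integrable_on {0..L}" and 0: "\<And>x. x \<in> {0..L} \<Longrightarrow> integral {0..x} g = 0"
  shows "AE x in lebesgue_on {0<..<L}. g x = 0"
proof -
  have gi: "g integrable_on cbox 0 L"
    using g absolutely_integrable_on_def by auto
  have sub: "integral K g = 0" if "K = cbox c d" "K \<subseteq> {0..L}" for K c d
  proof (cases "c \<le> d")
    case True
    with that have cd: "0 \<le> c" "d \<le> L" by auto
    have "integral {0..c} g + integral {c..d} g = integral {0..d} g"
      using cd True gi by (intro Henstock_Kurzweil_Integration.integral_combine)
        (auto intro: integrable_on_subinterval)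
    then show ?thesis using 0[of c] 0[of d] cd True that by simp
  qed (use that in auto)
  have "((\<lambda>x. \<bar>g x\<bar>) has_integral 0) (cbox 0 L)"
    unfolding has_integral
  proof (intro allI impI)
    fix e :: real assume "e > 0"
    obtain \<gamma> where \<gamma>: "gauge \<gamma>"
      "\<And>p. p tagged_partial_division_of cbox 0 L \<Longrightarrow> \<gamma> fine p \<Longrightarrow>
         (\<Sum>(x,k)\<in>p. norm (measure lborel k *\<^sub>R g x - integral k g)) < e"
      using Henstock_lemma[OF gi \<open>e > 0\<close>] by blast
    show "\<exists>\<gamma>. gauge \<gamma> \<and> (\<forall>\<D>. \<D> tagged_division_of cbox 0 L \<and> \<gamma> fine \<D> \<longrightarrow>
        norm ((\<Sum>(x, k)\<in>\<D>. measure lborel k *\<^sub>R \<bar>g x\<bar>) - 0) < e)"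
    proof (intro exI conjI allI impI)
      fix \<D> assume D: "\<D> tagged_division_of cbox 0 L \<and> \<gamma> fine \<D>"
      then have "(\<Sum>(x,k)\<in>\<D>. norm (measure lborel k *\<^sub>R g x - integral k g)) < e"
        by (intro \<gamma>(2)) (auto simp: tagged_division_of_def)
      also have "(\<Sum>(x,k)\<in>\<D>. norm (measure lborel k *\<^sub>R g x - integral k g))
          = (\<Sum>(x,k)\<in>\<D>. measure lborel k *\<^sub>R \<bar>g x\<bar>)"
      proof (intro sum.cong refl, clarify)
        fix x k assume "(x, k) \<in> \<D>"
        then obtain c d where "k = cbox c d" "k \<subseteq> cbox 0 L"
          using D tagged_division_ofD(3,4) by metis
        then show "norm (measure lborel k *\<^sub>R g x - integral k g) = measure lborel k *\<^sub>R \<bar>g x\<bar>"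
          using sub[of k c d] by (auto simp: abs_mult)
      qed
      moreover have "0 \<le> (\<Sum>(x,k)\<in>\<D>. measure lborel k *\<^sub>R \<bar>g x\<bar>)"
        by (intro sum_nonneg) auto
      ultimately show "norm ((\<Sum>(x, k)\<in>\<D>. measure lborel k *\<^sub>R \<bar>g x\<bar>) - 0) < e" by simp
    qed (rule \<gamma>)
  qed
  then have "integral {0..L} (\<lambda>x. \<bar>g x\<bar>) = 0" by (simp add: integral_unique)
  moreover have a: "(\<lambda>x. \<bar>g x\<bar>) absolutely_integrable_on {0..L}"
    using absolutely_integrable_norm[OF g] by (simp add: o_def)
  ultimately have "(LINT x|lebesgue_on {0<..<L}. \<bar>g x\<bar>) = 0"
    using LINT_open_interval_eq by simp
  then show ?thesis
    using integral_nonneg_eq_0_iff_AE[of "lebesgue_on {0<..<L}" "\<lambda>x. \<bar>g x\<bar>"] a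
    by (simp add: integrable_open_interval_iff)
qed

lemma absolutely_integrable_imp_integrable:
  "f absolutely_integrable_on S \<Longrightarrow> f integrable_on S" for f :: "real \<Rightarrow> real"
  by (rule set_lebesgue_integral_eq_integral)

lemma absolutely_integrable_continuous_mult:
  fixes u f :: "real \<Rightarrow> real"
  assumes "continuous_on {a..b} u" "f absolutely_integrable_on {a..b}"
  shows "(\<lambda>x. u x * f x) absolutely_integrable_on {a..b}"
  using assms
  by (intro absolutely_integrable_bounded_measurable_product_real
        continuous_imp_measurable_on_sets_lebesgue compact_imp_bounded
        compact_continuous_image) auto

text \<open>Absolutely continuous functions on \<open>{0..L}\<close> together with a density, which matters only up to
  null sets. The equation is oriented so that it can serve as a rewrite rule for integrals.\<close>

definition primitive :: "real \<Rightarrow> (real \<Rightarrow> real) \<Rightarrow> (real \<Rightarrow> real) \<Rightarrow> bool" where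
  "primitive L u g \<longleftrightarrow>
     g absolutely_integrable_on {0..L} \<and> (\<forall>x\<in>{0..L}. integral {0..x} g = u x - u 0)"

lemma primitiveD:
  assumes "primitive L u g"
  shows "g absolutely_integrable_on {0..L}" "x \<in> {0..L} \<Longrightarrow> integral {0..x} g = u x - u 0"
  using assms unfolding primitive_def by auto

lemma primitive_integrable_on:
  assumes "primitive L u g" "0 \<le> a" "b \<le> L"
  shows "g integrable_on {a..b}"
  by (rule integrable_on_subinterval[OF absolutely_integrable_imp_integrable[OF primitiveD(1)[OF assms(1)]]])
    (use assms in auto)

lemma primitive_continuous_on:
  assumes "primitive L u g"
  shows "continuous_on {0..L} u"
proof -
  have "continuous_on {0..L} (\<lambda>x. u 0 + integral {0..x} g)"
    using assms by (intro continuous_intros indefinite_integral_continuous_1 primitive_integrable_on) auto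
  then show ?thesis
    using primitiveD(2)[OF assms] by (subst continuous_on_cong[OF refl]) auto
qed

lemma primitive_integral:
  assumes p: "primitive L u g" and "0 \<le> a" "a \<le> b" "b \<le> L"
  shows "integral {a..b} g = u b - u a"
proof -
  have "integral {0..a} g + integral {a..b} g = integral {0..b} g"
    using assms by (intro Henstock_Kurzweil_Integration.integral_combine primitive_integrable_on[OF p]) auto
  then show ?thesis
    using primitiveD(2)[OF p, of a] primitiveD(2)[OF p, of b] assms by auto
qed

lemma primitive_cong:
  assumes "primitive L u g" "\<And>x. x \<in> {0..L} \<Longrightarrow> u x = u' x" "\<And>x. x \<in> {0..L} \<Longrightarrow> g x = g' x"
  shows "primitive L u' g'"
proof -
  have "g' absolutely_integrable_on {0..L}"
    using assms(3) primitiveD(1)[OF assms(1)]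
    by (subst set_integrable_cong[of lebesgue lebesgue "{0..L}" "{0..L}" g' g]) auto
  moreover have "integral {0..x} g' = u' x - u' 0" if "x \<in> {0..L}" for x
  proof -
    have "integral {0..x} g' = integral {0..x} g"
      using that assms(3) by (intro integral_cong) auto
    then show ?thesis using primitiveD(2)[OF assms(1) that] assms(2)[of x] assms(2)[of 0] that by auto
  qed
  ultimately show ?thesis unfolding primitive_def by auto
qed

lemma primitive_add:
  assumes "primitive L u f" "primitive L z g"
  shows "primitive L (\<lambda>x. u x + z x) (\<lambda>x. f x + g x)"
  unfolding primitive_def
proof (intro conjI ballI set_integral_add)
  fix x assume x: "x \<in> {0..L}"
  have "integral {0..x} (\<lambda>x. f x + g x) = integral {0..x} f + integral {0..x} g"
    using x assms by (intro Henstock_Kurzweil_Integration.integral_add primitive_integrable_on) auto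
  then show "integral {0..x} (\<lambda>x. f x + g x) = u x + z x - (u 0 + z 0)"
    using primitiveD(2)[OF assms(1) x] primitiveD(2)[OF assms(2) x] by simp
qed (use assms in \<open>auto dest: primitiveD(1)\<close>)

lemma primitive_cmult:
  assumes "primitive L u f"
  shows "primitive L (\<lambda>x. c * u x) (\<lambda>x. c * f x)"
  unfolding primitive_def
  using assms primitiveD(2)[OF assms]
  by (auto dest: primitiveD(1) simp: right_diff_distrib)

lemma primitive_diff:
  assumes "primitive L u f" "primitive L z g"
  shows "primitive L (\<lambda>x. u x - z x) (\<lambda>x. f x - g x)"
  using primitive_add[OF assms(1) primitive_cmult[OF assms(2), of "-1"]] by simp

lemma primitive_sum:
  assumes "\<And>i. i \<in> I \<Longrightarrow> primitive L (u i) (g i)"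
  shows "primitive L (\<lambda>x. \<Sum>i\<in>I. u i x) (\<lambda>x. \<Sum>i\<in>I. g i x)"
  using assms
proof (induction I rule: infinite_finite_induct)
  case (insert i I)
  then show ?case by (auto intro!: primitive_add)
qed (auto simp: primitive_def)

lemma primitive_has_vector_derivative:
  assumes "\<And>x. x \<in> {0..L} \<Longrightarrow> (u has_real_derivative g x) (at x within {0..L})"
    and "continuous_on {0..L} g"
  shows "primitive L u g"
  unfolding primitive_def
proof (intro conjI ballI absolutely_integrable_continuous_real assms)
  fix x assume x: "x \<in> {0..L}"
  have "(g has_integral u x - u 0) {0..x}"
    using x assms(1) by (intro fundamental_theorem_of_calculus)
      (auto simp: has_real_derivative_iff_has_vector_derivative[symmetric] intro!: DERIV_subset[OF assms(1)])
  then show "integral {0..x} g = u x - u 0" by (simp add: integral_unique)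
qed

text \<open>Splitting off the values at 0 reduces the product rule to indefinite integrals.\<close>

lemma primitive_mult:
  assumes u: "primitive L u f" and z: "primitive L z g"
  shows "primitive L (\<lambda>x. u x * z x) (\<lambda>x. f x * z x + u x * g x)"
  unfolding primitive_def
proof (intro conjI ballI)
  have "(\<lambda>x. z x * f x + u x * g x) absolutely_integrable_on {0..L}"
    using assms by (intro set_integral_add absolutely_integrable_continuous_mult primitive_continuous_on)
      (auto dest: primitiveD(1))
  then show "(\<lambda>x. f x * z x + u x * g x) absolutely_integrable_on {0..L}" by (simp add: mult.commute)
next
  fix x assume x: "x \<in> {0..L}"
  have ai: "h absolutely_integrable_on {0..x}" if "h absolutely_integrable_on {0..L}" for h :: "real \<Rightarrow> real"
    using x by (intro set_integrable_subset[OF that]) auto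
  note f = ai[OF primitiveD(1)[OF u]] and g = ai[OF primitiveD(1)[OF z]]
  have i: "(\<lambda>t. c * f t + d * g t) integrable_on {0..x}" for c d
    using f g by (intro absolutely_integrable_imp_integrable set_integral_add set_integrable_mult_right) auto
  have ci: "continuous_on {0..x} (\<lambda>t. integral {0..t} h)" if "h absolutely_integrable_on {0..x}" for h :: "real \<Rightarrow> real"
    using that absolutely_integrable_imp_integrable by (intro indefinite_integral_continuous_1)
  have "(\<lambda>t. integral {0..t} g * f t + integral {0..t} f * g t) absolutely_integrable_on {0..x}"
    using f g by (intro set_integral_add absolutely_integrable_continuous_mult ci)
  then have j: "(\<lambda>t. f t * integral {0..t} g + integral {0..t} f * g t) integrable_on {0..x}"
    using absolutely_integrable_imp_integrable by (simp add: mult.commute)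
  have "integral {0..x} (\<lambda>t. f t * z t + u t * g t)
     = integral {0..x} (\<lambda>t. (z 0 * f t + u 0 * g t) + (f t * integral {0..t} g + integral {0..t} f * g t))"
    proof (intro integral_cong)
    fix t assume "t \<in> {0..x}"
    then have "t \<in> {0..L}" using x by auto
    then have "z t = z 0 + integral {0..t} g" "u t = u 0 + integral {0..t} f"
      using primitiveD(2)[OF u, of t] primitiveD(2)[OF z, of t] by auto
    then show "f t * z t + u t * g t
        = (z 0 * f t + u 0 * g t) + (f t * integral {0..t} g + integral {0..t} f * g t)"
      by (simp add: algebra_simps)
  qed
  also have "\<dots> = integral {0..x} (\<lambda>t. z 0 * f t + u 0 * g t) + integral {0..x} f * integral {0..x} g"
    using integral_mult_integral_triangle[OF f g] i j by (simp add: Henstock_Kurzweil_Integration.integral_add)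
  also have "integral {0..x} (\<lambda>t. z 0 * f t + u 0 * g t) = z 0 * integral {0..x} f + u 0 * integral {0..x} g"
    using f g by (subst Henstock_Kurzweil_Integration.integral_add)
      (auto intro!: absolutely_integrable_imp_integrable set_integrable_mult_right)
  finally show "integral {0..x} (\<lambda>t. f t * z t + u t * g t) = u x * z x - u 0 * z 0"
    using primitiveD(2)[OF u x] primitiveD(2)[OF z x] by (simp add: algebra_simps)
qed

lemma primitive_cong_AE:
  assumes p: "primitive L u g" and h: "h absolutely_integrable_on {0..L}"
    and eq: "AE x in lebesgue_on {0<..<L}. g x = h x"
  shows "primitive L u h"
  unfolding primitive_def
proof (intro conjI ballI h)
  fix x assume x: "x \<in> {0..L}"
  have "AE x in lebesgue. x \<in> {0<..<L} \<longrightarrow> g x = h x"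
    using eq by (subst (asm) AE_restrict_space_iff) auto
  then obtain Z where Z: "Z \<in> null_sets lebesgue" "{x \<in> space lebesgue. \<not> (x \<in> {0<..<L} \<longrightarrow> g x = h x)} \<subseteq> Z"
    by (auto simp: eventually_ae_filter)
  have "negligible (Z \<union> {0, L})" using Z(1) by (simp add: negligible_iff_null_sets negligible_Un)
  then have "integral {0..x} h = integral {0..x} g"
  proof (rule integral_spike)
    fix t assume "t \<in> {0..x} - (Z \<union> {0, L})"
    then have "t \<in> {0<..<L}" "t \<notin> Z" using x by auto
    then show "g t = h t" using Z(2) by fastforce
  qed
  then show "integral {0..x} h = u x - u 0" using primitiveD(2)[OF p x] by simp
qed

lemma primitive_unique_AE:
  assumes "primitive L u g" "primitive L u h"
  shows "AE x in lebesgue_on {0<..<L}. g x = h x"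
proof -
  have "primitive L (\<lambda>x. u x - u x) (\<lambda>x. g x - h x)"
    using assms by (rule primitive_diff)
  then have "AE x in lebesgue_on {0<..<L}. g x - h x = 0"
    by (intro integral_Icc_zero_imp_AE_zero) (auto simp: primitive_def)
  then show ?thesis by simp
qed

lemma primitive_unique_continuous:
  assumes "0 < L" "primitive L u g" "primitive L u h" "continuous_on {0..L} g" "continuous_on {0..L} h"
    and x: "x \<in> {0..L}"
  shows "g x = h x"
proof -
  have *: "((\<lambda>x. integral {0..x} g) has_vector_derivative g x) (at x within cbox 0 L)"
    "((\<lambda>x. integral {0..x} h) has_vector_derivative h x) (at x within cbox 0 L)"
    using assms integral_has_vector_derivative by auto
  have "((\<lambda>x. integral {0..x} g) has_vector_derivative h x) (at x within cbox 0 L)"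
    using x primitiveD(2)[OF assms(2)] primitiveD(2)[OF assms(3)]
    by (intro has_vector_derivative_transform[OF _ _ *(2)]) force+
  with * show ?thesis
    using assms by (intro vector_derivative_unique_within_closed_interval[of 0 L x "\<lambda>x. integral {0..x} g"]) auto
qed

section \<open>Weak derivatives are densities of primitives\<close>

lemma primitive_imp_weak_deriv:
  assumes "0 < L" and p: "primitive L u g"
  shows "weak_deriv L u g"
  unfolding weak_deriv_def
proof (intro allI impI, elim conjE exE)
  fix \<phi> \<phi>' :: "real \<Rightarrow> real" and K
  assume \<phi>: "\<forall>x. (\<phi> has_real_derivative \<phi>' x) (at x)" "continuous_on UNIV \<phi>'"
    and K: "compact K" "K \<subseteq> {0<..<L}" "\<forall>x. x \<notin> K \<longrightarrow> \<phi> x = 0"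
  have q: "primitive L \<phi> \<phi>'"
    using \<phi> by (intro primitive_has_vector_derivative) (auto intro: DERIV_subset continuous_on_subset)
  have 0: "\<phi> 0 = 0" "\<phi> L = 0" using K by auto
  have "(\<lambda>x. u x * \<phi>' x) absolutely_integrable_on {0..L}"
    "(\<lambda>x. \<phi> x * g x) absolutely_integrable_on {0..L}"
    using p q by (auto intro!: absolutely_integrable_continuous_mult primitive_continuous_on dest: primitiveD(1))
  then have ai: "(\<lambda>x. u x * \<phi>' x) absolutely_integrable_on {0..L}"
    "(\<lambda>x. g x * \<phi> x) absolutely_integrable_on {0..L}" by (simp_all add: mult.commute)
  have "integral {0..L} (\<lambda>x. g x * \<phi> x + u x * \<phi>' x) = 0"
    using primitiveD(2)[OF primitive_mult[OF p q], of L] \<open>0 < L\<close> 0 by simp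
  then show "(LINT x|lebesgue_on {0<..<L}. u x * \<phi>' x) = - (LINT x|lebesgue_on {0<..<L}. g x * \<phi> x)"
    using ai absolutely_integrable_imp_integrable
    by (simp add: LINT_open_interval_eq Henstock_Kurzweil_Integration.integral_add)
qed

text \<open>Test with an antiderivative of \<open>(d - c) * \<psi>\<close>, where \<open>\<psi>\<close> is a bump with support \<open>{a..b}\<close> and \<open>c\<close>
  is the mean of \<open>d\<close> with weight \<open>\<psi>\<close>. This choice of \<open>c\<close> makes the test function vanish outside
  \<open>{a..b}\<close>, and the hypothesis becomes \<open>\<integral> (d - c)\<^sup>2 * \<psi> = 0\<close>.\<close>

lemma du_Bois_Reymond:
  fixes d :: "real \<Rightarrow> real"
  assumes d: "continuous_on {0..L} d"
    and test: "\<And>\<phi> \<phi>' K. (\<And>x. (\<phi> has_real_derivative \<phi>' x) (at x)) \<Longrightarrow> continuous_on UNIV \<phi>' \<Longrightarrow>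
      compact K \<Longrightarrow> K \<subseteq> {0<..<L} \<Longrightarrow> (\<And>x. x \<notin> K \<Longrightarrow> \<phi> x = 0) \<Longrightarrow>
      integral {0..L} (\<lambda>x. d x * \<phi>' x) = 0"
    and x: "x \<in> {0..L}"
  shows "d x = d 0"
proof -
  have local: "\<exists>c. \<forall>t. a < t \<and> t < b \<longrightarrow> d t = c" if ab: "0 < a" "a < b" "b < L" for a b
  proof -
    define \<psi> where "\<psi> = (\<lambda>t. max 0 ((t - a) * (b - t)))"
    have \<psi>0: "\<psi> t \<ge> 0" for t by (simp add: \<psi>_def)
    have \<psi>pos: "\<psi> t > 0" if "a < t" "t < b" for t
      using that by (simp add: \<psi>_def less_max_iff_disj)
    have \<psi>out: "\<psi> t = 0" if "t \<le> a \<or> b \<le> t" for t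
      using that ab by (auto simp: \<psi>_def max_def mult_le_0_iff zero_le_mult_iff not_le)
    have \<psi>c: "continuous_on S \<psi>" for S unfolding \<psi>_def by (intro continuous_intros)
    have "integral {0..L} \<psi> \<noteq> 0"
    proof
      assume "integral {0..L} \<psi> = 0"
      then have "\<psi> ((a + b) / 2) = 0"
        using integral_eq_0_iff[of 0 L \<psi>] \<psi>c \<psi>0 ab by auto
      with \<psi>pos[of "(a + b) / 2"] ab show False by auto
    qed
    define c where "c = integral {0..L} (\<lambda>t. d t * \<psi> t) / integral {0..L} \<psi>"
    \<comment> \<open>A test function lives on the whole line, so \<open>d\<close> is extended by constants.\<close>
    define d' where "d' = (\<lambda>t. d (max 0 (min L t)))"
    have d'c: "continuous_on S d'" for S
      unfolding d'_def by (rule continuous_on_compose2[OF d]) (use ab in \<open>auto intro!: continuous_intros\<close>)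
    have d': "d' t = d t" if "t \<in> {0..L}" for t using that by (auto simp: d'_def max_def min_def)
    define \<eta> where "\<eta> = (\<lambda>t. (d' t - c) * \<psi> t)"
    have \<eta>c: "continuous_on S \<eta>" for S unfolding \<eta>_def by (intro continuous_intros d'c \<psi>c)
    have ic: "h integrable_on {p..q}" if "continuous_on {p..q} h" for h :: "real \<Rightarrow> real" and p q
      using that by (rule integrable_continuous_real)
    have "integral {0..L} \<eta> = integral {0..L} (\<lambda>t. d t * \<psi> t - c * \<psi> t)"
      using d' by (intro integral_cong) (auto simp: \<eta>_def algebra_simps)
    also have "\<dots> = integral {0..L} (\<lambda>t. d t * \<psi> t) - c * integral {0..L} \<psi>"
      by (subst Henstock_Kurzweil_Integration.integral_diff) (auto intro!: ic continuous_intros \<psi>c d)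
    also have "\<dots> = 0" using \<open>integral {0..L} \<psi> \<noteq> 0\<close> by (simp add: c_def)
    finally have \<eta>int: "integral {0..L} \<eta> = 0" .
    have "\<exists>F. \<forall>x::real. -\<infinity> < ereal x \<longrightarrow> ereal x < \<infinity> \<longrightarrow> (F has_vector_derivative \<eta> x) (at x)"
      by (rule einterval_antiderivative) (use \<eta>c[of UNIV] in \<open>auto simp: continuous_on_eq_continuous_at\<close>)
    then obtain F where F: "\<And>x. (F has_vector_derivative \<eta> x) (at x)" by auto
    have FTC: "integral {p..q} \<eta> = F q - F p" if "p \<le> q" for p q
      using that by (intro integral_unique fundamental_theorem_of_calculus has_vector_derivative_at_within[OF F])
    have out: "integral {p..q} \<eta> = 0" if "q \<le> a \<or> b \<le> p" for p q
    proof -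
      have "integral {p..q} \<eta> = integral {p..q} (\<lambda>_. 0)"
        using that by (intro integral_cong) (auto simp: \<eta>_def \<psi>out)
      then show ?thesis by simp
    qed
    define \<phi> where "\<phi> = (\<lambda>t. F t - F a)"
    have "integral {0..L} (\<lambda>x. d x * \<eta> x) = 0"
    proof (rule test[of \<phi> _ "{a..b}"])
      show "(\<phi> has_real_derivative \<eta> x) (at x)" for x
        unfolding \<phi>_def has_real_derivative_iff_has_vector_derivative
        using F by (auto intro!: derivative_eq_intros)
      fix x assume "x \<notin> {a..b}"
      then consider "x < a" | "b < x" by force
      then show "\<phi> x = 0"
      proof cases
        case 1
        then show ?thesis using FTC[of x a] out[of a x] by (simp add: \<phi>_def)
      next
        case 2
        have "F a - F 0 = 0" using FTC[of 0 a] out[of a 0] ab by simp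
        moreover have "F L - F 0 = 0" using FTC[of 0 L] \<eta>int ab by simp
        moreover have "F x = F b" using FTC[of b x] out[of x b] 2 by simp
        moreover have "F L = F b" using FTC[of b L] out[of L b] ab by simp
        ultimately show ?thesis by (simp add: \<phi>_def)
      qed
    qed (use ab \<eta>c in auto)
    have "integral {0..L} (\<lambda>t. (d t - c)\<^sup>2 * \<psi> t) = integral {0..L} (\<lambda>t. d t * \<eta> t - c * \<eta> t)"
      using d' by (intro integral_cong) (auto simp: \<eta>_def algebra_simps power2_eq_square)
    also have "\<dots> = 0"
      using \<open>integral {0..L} (\<lambda>x. d x * \<eta> x) = 0\<close> \<eta>int
      by (subst Henstock_Kurzweil_Integration.integral_diff) (auto intro!: ic continuous_intros \<eta>c d)
    finally have "\<forall>t\<in>{0..L}. (d t - c)\<^sup>2 * \<psi> t = 0"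
      using ab by (subst (asm) integral_eq_0_iff) (auto intro!: continuous_intros \<psi>c d \<psi>0 mult_nonneg_nonneg)
    then have "d t = c" if "a < t" "t < b" for t
      using that ab \<psi>pos[of t] by force
    then show ?thesis by blast
  qed
  show ?thesis
  proof (cases "0 < L")
    case True
    have eq: "d s = d t" if "s \<in> {0<..<L}" "t \<in> {0<..<L}" for s t
    proof -
      define a b where "a = min s t / 2" and "b = (max s t + L) / 2"
      have "0 < a" "b < L" "a < s" "a < t" "s < b" "t < b"
        using that unfolding a_def b_def by (auto simp: min_def max_def)
      with local[of a b] show ?thesis by fastforce
    qed
    have "d y = d (L/2)" if "y \<in> {0..L}" for y
      using d True that by (rule_tac continuous_constant_on_closure[of "{0<..<L}" d "d (L/2)"]) (auto intro: eq)
    from this[of x] this[of 0] show ?thesis using x by auto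
  next
    case False
    with x have "x = 0" by simp
    then show ?thesis by simp
  qed
qed

text \<open>The difference between \<open>u\<close> and an indefinite integral of \<open>g\<close> has weak derivative zero.\<close>

lemma weak_deriv_imp_primitive:
  assumes "0 < L" and u: "continuous_on {0..L} u" and g: "g absolutely_integrable_on {0..L}"
    and w: "weak_deriv L u g"
  shows "primitive L u g"
proof -
  define U where "U = (\<lambda>x. integral {0..x} g)"
  have U: "primitive L U g" unfolding primitive_def U_def using g by auto
  then have wU: "weak_deriv L U g" using \<open>0 < L\<close> by (intro primitive_imp_weak_deriv)
  note Uc = primitive_continuous_on[OF U]
  have "u x - U x = u 0 - U 0" if "x \<in> {0..L}" for x
  proof (rule du_Bois_Reymond[where d = "\<lambda>x. u x - U x" and L = L])
    fix \<phi> \<phi>' :: "real \<Rightarrow> real" and K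
    assume \<phi>: "\<And>x. (\<phi> has_real_derivative \<phi>' x) (at x)" "continuous_on UNIV \<phi>'"
      "compact K" "K \<subseteq> {0<..<L}" "\<And>x. x \<notin> K \<Longrightarrow> \<phi> x = 0"
    have \<phi>c: "continuous_on {0..L} \<phi>'" using \<phi>(2) continuous_on_subset by blast
    have "\<exists>K. compact K \<and> K \<subseteq> {0<..<L} \<and> (\<forall>x. x \<notin> K \<longrightarrow> \<phi> x = 0)"
      using \<phi> by blast
    then have "(LINT x|lebesgue_on {0<..<L}. u x * \<phi>' x) = (LINT x|lebesgue_on {0<..<L}. U x * \<phi>' x)"
      using w[unfolded weak_deriv_def, rule_format, of \<phi> \<phi>'] wU[unfolded weak_deriv_def, rule_format, of \<phi> \<phi>'] \<phi>
      by auto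
    then have "integral {0..L} (\<lambda>x. u x * \<phi>' x) = integral {0..L} (\<lambda>x. U x * \<phi>' x)"
      using u Uc \<phi>c by (simp add: LINT_open_interval_eq absolutely_integrable_continuous_real continuous_on_mult)
    then show "integral {0..L} (\<lambda>x. (u x - U x) * \<phi>' x) = 0"
      using u Uc \<phi>c by (simp add: left_diff_distrib Henstock_Kurzweil_Integration.integral_diff
        integrable_continuous_real continuous_on_mult)
  qed (use that u Uc in \<open>auto intro!: continuous_intros\<close>)
  then have "u x - integral {0..x} g = u 0" if "x \<in> {0..L}" for x
    using that by (simp add: U_def)
  then have "integral {0..x} g = u x - u 0" if "x \<in> {0..L}" for x
    using that by (metis diff_diff_eq2 add_diff_cancel_left' diff_add_cancel)
  then show ?thesis unfolding primitive_def using g by blast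
qed

section \<open>The Sobolev spaces of an interval\<close>

lemma L2_imp_absolutely_integrable:
  assumes "g \<in> L2 L"
  shows "g absolutely_integrable_on {0..L}" "(\<lambda>x. (g x)\<^sup>2) absolutely_integrable_on {0..L}"
proof -
  interpret finite_measure "lebesgue_on {0<..<L}" by (intro finite_measure_lebesgue_on) auto
  have "integrable (lebesgue_on {0<..<L}) g"
  proof (rule Bochner_Integration.integrable_bound)
    show "integrable (lebesgue_on {0<..<L}) (\<lambda>x. 1 + (g x)\<^sup>2)"
      using assms by (auto simp: L2_def)
    have "\<bar>y\<bar> \<le> 1 + y\<^sup>2" for y :: real
    proof -
      have "0 \<le> (\<bar>y\<bar> - 1)\<^sup>2 + \<bar>y\<bar>" by simp
      then show ?thesis by (simp add: power2_eq_square algebra_simps abs_mult_self_eq)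
    qed
    then show "AE x in lebesgue_on {0<..<L}. norm (g x) \<le> norm (1 + (g x)\<^sup>2)" by auto
  qed (use assms in \<open>auto simp: L2_def\<close>)
  then show "g absolutely_integrable_on {0..L}" by (simp add: integrable_open_interval_iff)
  show "(\<lambda>x. (g x)\<^sup>2) absolutely_integrable_on {0..L}"
    using assms by (simp add: integrable_open_interval_iff[symmetric] L2_def)
qed

lemma continuous_on_imp_measurable_open_interval:
  "continuous_on {0..L} u \<Longrightarrow> u \<in> borel_measurable (lebesgue_on {0<..<L})" for u :: "real \<Rightarrow> real"
  by (rule continuous_imp_measurable_on_sets_lebesgue) (auto elim: continuous_on_subset)

lemma continuous_on_imp_L2: "continuous_on {0..L} u \<Longrightarrow> u \<in> L2 L"
  unfolding L2_def
  by (auto simp: integrable_open_interval_iff continuous_on_imp_measurable_open_interval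
      intro!: absolutely_integrable_continuous_real continuous_intros)

lemma L2_add:
  assumes "f \<in> L2 L" "g \<in> L2 L"
  shows "(\<lambda>x. f x + g x) \<in> L2 L"
proof -
  note [measurable] = assms[unfolded L2_def, simplified, THEN conjunct1]
  have "integrable (lebesgue_on {0<..<L}) (\<lambda>x. (f x + g x)\<^sup>2)"
  proof (rule Bochner_Integration.integrable_bound)
    show "integrable (lebesgue_on {0<..<L}) (\<lambda>x. 2 * (f x)\<^sup>2 + 2 * (g x)\<^sup>2)"
      using assms by (auto simp: L2_def)
    have "(a + b)\<^sup>2 \<le> 2 * a\<^sup>2 + 2 * b\<^sup>2" for a b :: real
      using zero_le_power2[of "a - b"] by (simp add: power2_eq_square algebra_simps)
    then show "AE x in lebesgue_on {0<..<L}. norm ((f x + g x)\<^sup>2) \<le> norm (2 * (f x)\<^sup>2 + 2 * (g x)\<^sup>2)"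
      by auto
  qed auto
  then show ?thesis unfolding L2_def by auto
qed

lemma L2_mult_continuous:
  assumes u: "continuous_on {0..L} u" and "g \<in> L2 L"
  shows "(\<lambda>x. u x * g x) \<in> L2 L"
proof -
  note [measurable] = assms(2)[unfolded L2_def, simplified, THEN conjunct1]
    continuous_on_imp_measurable_open_interval[OF u]
  have "(\<lambda>x. (u x)\<^sup>2 * (g x)\<^sup>2) absolutely_integrable_on {0..L}"
    using u L2_imp_absolutely_integrable(2)[OF assms(2)]
    by (intro absolutely_integrable_continuous_mult continuous_intros)
  then show ?thesis unfolding L2_def by (auto simp: integrable_open_interval_iff power_mult_distrib)
qed

lemma L2_cmult: "g \<in> L2 L \<Longrightarrow> (\<lambda>x. c * g x) \<in> L2 L"
  by (rule L2_mult_continuous) auto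

lemma L2_diff: "f \<in> L2 L \<Longrightarrow> g \<in> L2 L \<Longrightarrow> (\<lambda>x. f x - g x) \<in> L2 L"
  using L2_add[of f L "\<lambda>x. (-1) * g x"] L2_cmult[of g L "-1"] by simp

lemma L2_sum: "(\<And>i. i \<in> I \<Longrightarrow> g i \<in> L2 L) \<Longrightarrow> (\<lambda>x. \<Sum>i\<in>I. g i x) \<in> L2 L"
  by (induction I rule: infinite_finite_induct) (simp_all add: L2_add continuous_on_imp_L2)

lemma L2_mult_absolutely_integrable:
  assumes "f \<in> L2 L" "g \<in> L2 L"
  shows "(\<lambda>x. f x * g x) absolutely_integrable_on {0..L}"
proof -
  have "(\<lambda>x. (f x + g x)\<^sup>2) absolutely_integrable_on {0..L}"
    "(\<lambda>x. (f x - g x)\<^sup>2) absolutely_integrable_on {0..L}"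
    using assms by (auto intro!: L2_imp_absolutely_integrable L2_add L2_diff)
  then have "(\<lambda>x. (1/4) * ((f x + g x)\<^sup>2 - (f x - g x)\<^sup>2)) absolutely_integrable_on {0..L}"
    by (intro set_integrable_mult_right set_integral_diff)
  also have "(\<lambda>x. (1/4) * ((f x + g x)\<^sup>2 - (f x - g x)\<^sup>2)) = (\<lambda>x. f x * g x)"
    by (auto simp: power2_eq_square algebra_simps)
  finally show ?thesis .
qed

lemma primitive_L2_imp_H1:
  assumes "0 < L" "primitive L u g" "g \<in> L2 L"
  shows "u \<in> H1 L"
  unfolding H1_def using assms primitive_continuous_on[OF assms(2)]
  by (auto intro!: continuous_on_imp_L2 bexI[of _ g] primitive_imp_weak_deriv)

lemma H1_primitive:
  assumes "0 < L" "u \<in> H1 L"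
  shows "wderiv L u \<in> L2 L" "primitive L u (wderiv L u)"
proof -
  have "\<exists>g. g \<in> L2 L \<and> weak_deriv L u g" using assms by (auto simp: H1_def)
  then have *: "wderiv L u \<in> L2 L \<and> weak_deriv L u (wderiv L u)"
    unfolding wderiv_def by (rule someI_ex)
  then show "wderiv L u \<in> L2 L" by simp
  show "primitive L u (wderiv L u)"
    using * assms L2_imp_absolutely_integrable by (intro weak_deriv_imp_primitive) (auto simp: H1_def)
qed

lemma wderiv_AE_eq:
  assumes "0 < L" "primitive L u g" "g \<in> L2 L"
  shows "AE x in lebesgue_on {0<..<L}. wderiv L u x = g x"
  using H1_primitive(2)[OF assms(1) primitive_L2_imp_H1[OF assms]] assms(2)
  by (rule primitive_unique_AE)

lemma H2_primitive:
  assumes "0 < L" "u \<in> H2 L"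
  shows "cderiv L u \<in> H1 L" "primitive L u (cderiv L u)"
proof -
  have "\<exists>p. p \<in> H1 L \<and> weak_deriv L u p" using assms by (auto simp: H2_def)
  then have *: "cderiv L u \<in> H1 L \<and> weak_deriv L u (cderiv L u)"
    unfolding cderiv_def by (rule someI_ex)
  then show "cderiv L u \<in> H1 L" by simp
  show "primitive L u (cderiv L u)"
    using * assms by (intro weak_deriv_imp_primitive absolutely_integrable_continuous_real)
      (auto simp: H1_def H2_def)
qed

lemma primitive_H1_imp_H2:
  assumes "0 < L" "primitive L u p" "p \<in> H1 L"
  shows "u \<in> H2 L" "x \<in> {0..L} \<Longrightarrow> cderiv L u x = p x"
proof -
  have pc: "continuous_on {0..L} p" using assms(3) by (auto simp: H1_def)
  show u: "u \<in> H2 L"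
    unfolding H2_def using assms pc
    by (auto intro!: primitive_L2_imp_H1[of L u p] continuous_on_imp_L2 bexI[of _ p] primitive_imp_weak_deriv)
  show "cderiv L u x = p x" if "x \<in> {0..L}"
    using H2_primitive[OF assms(1) u] assms pc that
    by (intro primitive_unique_continuous[of L u]) (auto simp: H1_def)
qed

text \<open>Frees the inner product from the representatives chosen by \<open>wderiv\<close>.\<close>

lemma LINT_H1_inner:
  assumes "0 < L" and u: "primitive L u f" "f \<in> L2 L" and v: "primitive L v g" "g \<in> L2 L"
  shows "(LINT x|lebesgue_on {0<..<L}. u x * v x + wderiv L u x * wderiv L v x)
      = integral {0..L} (\<lambda>x. u x * v x + f x * g x)"
proof -
  have cont: "continuous_on {0..L} u" "continuous_on {0..L} v"
    using u v by (auto intro: primitive_continuous_on)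
  note [measurable] = continuous_on_imp_measurable_open_interval[OF cont(1)]
    continuous_on_imp_measurable_open_interval[OF cont(2)]
  have [measurable]: "h \<in> borel_measurable (lebesgue_on {0<..<L})" if "h \<in> L2 L" for h
    using that by (auto simp: L2_def)
  note [measurable] = H1_primitive(1)[OF assms(1) primitive_L2_imp_H1[OF assms(1) u]]
    H1_primitive(1)[OF assms(1) primitive_L2_imp_H1[OF assms(1) v]] u(2) v(2)
  have "AE x in lebesgue_on {0<..<L}. wderiv L u x = f x" "AE x in lebesgue_on {0<..<L}. wderiv L v x = g x"
    using assms by (auto intro: wderiv_AE_eq)
  then have "AE x in lebesgue_on {0<..<L}. u x * v x + wderiv L u x * wderiv L v x = u x * v x + f x * g x"
    by eventually_elim simp
  then have "(LINT x|lebesgue_on {0<..<L}. u x * v x + wderiv L u x * wderiv L v x)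
     = (LINT x|lebesgue_on {0<..<L}. u x * v x + f x * g x)"
    by (intro integral_cong_AE) measurable
  also have "\<dots> = integral {0..L} (\<lambda>x. u x * v x + f x * g x)"
    using cont u v by (intro LINT_open_interval_eq set_integral_add absolutely_integrable_continuous_real
      continuous_intros L2_mult_absolutely_integrable)
  finally show ?thesis .
qed

text \<open>Integrate \<open>(u\<^sup>2)' = 2 * u * u'\<close> from \<open>x\<close> to the end \<open>L\<close>, where \<open>u\<close> vanishes, and use
  \<open>- 2 * u * u' \<le> u\<^sup>2 + u'\<^sup>2\<close>. The Sobolev embedding thus has constant 1 on edges of any length.\<close>

lemma square_le_H1_energy:
  assumes u: "primitive L u g" and g: "g \<in> L2 L" and "u L = 0" and x: "x \<in> {0..L}"
  shows "(u x)\<^sup>2 \<le> integral {0..L} (\<lambda>x. u x * u x + g x * g x)"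
proof -
  note p = primitive_mult[OF u u]
  have i: "(\<lambda>x. u x * u x + g x * g x) integrable_on {0..L}"
    using g primitive_continuous_on[OF u]
    by (intro absolutely_integrable_imp_integrable set_integral_add absolutely_integrable_continuous_real
      continuous_intros L2_mult_absolutely_integrable)
  then have ix: "(\<lambda>x. u x * u x + g x * g x) integrable_on {x..L}"
    by (rule integrable_on_subinterval) (use x in auto)
  have "integral {x..L} (\<lambda>t. g t * u t + u t * g t) = - (u x * u x)"
    using primitive_integral[OF p, of x L] x \<open>u L = 0\<close> by simp
  then have "(u x)\<^sup>2 = integral {x..L} (\<lambda>t. - (g t * u t + u t * g t))"
    by (simp add: power2_eq_square)
  also have "\<dots> \<le> integral {x..L} (\<lambda>x. u x * u x + g x * g x)"
  proof (intro integral_le ix integrable_neg primitive_integrable_on[OF p])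
    fix t
    show "- (g t * u t + u t * g t) \<le> u t * u t + g t * g t"
      using zero_le_power2[of "u t + g t"] by (simp add: power2_eq_square algebra_simps)
  qed (use x in auto)
  also have "\<dots> \<le> integral {0..L} (\<lambda>x. u x * u x + g x * g x)"
    using x by (intro integral_subset_le i ix) auto
  finally show ?thesis .
qed

section \<open>Ordinary differential equations in a Banach space\<close>

text \<open>Integration is a contraction with factor \<open>1 / k\<close> when functions are measured with the weight
  \<open>exp (- k * t)\<close>. Gronwall's lemma and the existence of global solutions both rest on this.\<close>

lemma norm_integral_le_exp:
  fixes f :: "real \<Rightarrow> 'a::banach"
  assumes "0 \<le> t" "0 < k" "0 \<le> C" and f: "continuous_on {0..t} f"
    and le: "\<And>s. s \<in> {0..t} \<Longrightarrow> norm (f s) \<le> C * exp (k * s)"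
  shows "norm (integral {0..t} f) \<le> C / k * exp (k * t)"
proof -
  have h: "((\<lambda>s. C * exp (k * s)) has_integral (C / k * exp (k * t) - C / k * exp (k * 0))) {0..t}"
    using assms(1,2)
    by (intro fundamental_theorem_of_calculus)
      (auto simp: has_real_derivative_iff_has_vector_derivative[symmetric] intro!: derivative_eq_intros)
  have "norm (integral {0..t} f) \<le> integral {0..t} (\<lambda>s. C * exp (k * s))"
    using f le h by (intro integral_norm_bound_integral) (auto intro: integrable_continuous_real)
  also have "\<dots> = C / k * exp (k * t) - C / k" using integral_unique[OF h] by simp
  also have "\<dots> \<le> C / k * exp (k * t)" using assms by simp
  finally show ?thesis .
qed

text \<open>At a maximum \<open>m\<close> of \<open>d t * exp (- k * t)\<close> the hypothesis gives \<open>m \<le> (K / k) * m\<close>, where \<open>K < k\<close>.\<close>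

lemma Gronwall_zero:
  fixes d :: "real \<Rightarrow> real"
  assumes "0 \<le> K" and d: "continuous_on {0..T} d" "\<And>t. t \<in> {0..T} \<Longrightarrow> 0 \<le> d t"
    and le: "\<And>t. t \<in> {0..T} \<Longrightarrow> d t \<le> K * integral {0..t} d"
    and t: "t \<in> {0..T}"
  shows "d t = 0"
proof -
  define k where "k = 2 * K + 1"
  have k: "k > 0" using assms by (simp add: k_def)
  have "continuous_on {0..T} (\<lambda>s. d s * exp (- (k * s)))" by (intro continuous_intros d)
  then obtain t0 where t0: "t0 \<in> {0..T}"
    "\<And>s. s \<in> {0..T} \<Longrightarrow> d s * exp (- (k * s)) \<le> d t0 * exp (- (k * t0))"
    using continuous_attains_sup[of "{0..T}" "\<lambda>s. d s * exp (- (k * s))"] t by auto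
  define m where "m = d t0 * exp (- (k * t0))"
  have m0: "0 \<le> m" using d t0 by (simp add: m_def)
  have dm: "d s \<le> m * exp (k * s)" if "s \<in> {0..T}" for s
    using t0(2)[OF that] unfolding m_def[symmetric] by (simp add: exp_minus field_simps)
  have "norm (integral {0..t0} d) \<le> m / k * exp (k * t0)"
    using t0 d dm k m0 by (intro norm_integral_le_exp) (auto elim: continuous_on_subset)
  then have "K * integral {0..t0} d \<le> K * (m / k * exp (k * t0))"
    using assms(1) by (intro mult_left_mono) auto
  with le[OF t0(1)] have "d t0 \<le> K * (m / k * exp (k * t0))" by linarith
  then have "d t0 * exp (- (k * t0)) \<le> K * (m / k * exp (k * t0)) * exp (- (k * t0))"
    by (intro mult_right_mono) auto
  then have "m \<le> K * (m / k)" unfolding m_def[symmetric] by (simp add: exp_minus field_simps)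
  then have "m * k \<le> K * m" using k by (simp add: field_simps)
  then have "m * (K + 1) \<le> 0" by (simp add: k_def algebra_simps)
  then have "m \<le> 0" using assms(1) by (simp add: mult_le_0_iff)
  then have "d t \<le> 0" using dm[OF t] by (smt (verit) exp_gt_zero mult_nonpos_nonneg)
  with d(2)[OF t] show ?thesis by simp
qed

text \<open>Picard iteration for the rescaled unknown \<open>z t = exp (- k * t) *\<^sub>R G t\<close> with \<open>k = 2 * K\<close>. Since \<open>F\<close>
  grows at most linearly, the integral operator maps bounded continuous \<open>z\<close> to bounded ones, and it
  is a contraction with factor 1/2 on the half line. Negative times are replaced by 0.\<close>

lemma global_solution_of_Lipschitz_ODE:
  fixes F :: "'a::banach \<Rightarrow> 'a"
  assumes "0 < K" and F: "\<And>x y. norm (F x - F y) \<le> K * norm (x - y)"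
  shows "\<exists>G :: real \<Rightarrow> 'a. continuous_on UNIV G \<and> (\<forall>t\<ge>0. G t = integral {0..t} (\<lambda>s. F (G s)))"
proof -
  define k where "k = 2 * K"
  have k: "k > 0" using assms by (simp add: k_def)
  have Fc: "continuous_on S F" for S
    using F assms(1) by (intro lipschitz_on_continuous_on[of K] lipschitz_onI) (auto simp: dist_norm)
  define Y where "Y z s = exp (k * s) *\<^sub>R apply_bcontfun z s" for z :: "real \<Rightarrow>\<^sub>C 'a" and s
  have FYc: "continuous_on S (\<lambda>s. F (Y z s))" for S z
    unfolding Y_def by (intro continuous_on_compose2[OF Fc[of UNIV]] continuous_intros continuous_on_apply_bcontfun) auto
  have FYi: "(\<lambda>s. F (Y z s)) integrable_on {0..t}" for z t
    by (intro integrable_continuous_real FYc)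
  have normY: "norm (Y z s) \<le> norm z * exp (k * s)" for z s
    using norm_bounded[of z s] by (simp add: Y_def mult.commute)
  define I where "I z t = integral {0..max 0 t} (\<lambda>s. F (Y z s))" for z t
  have Ic: "continuous_on UNIV (I z)" for z
  proof -
    have "continuous_on (\<Union>n\<in>UNIV. {..<real n}) (I z)"
    proof (rule continuous_on_open_UN)
      fix n :: nat
      show "continuous_on {..<real n} (I z)"
        unfolding I_def
        by (rule continuous_on_compose2[OF indefinite_integral_continuous_1[OF FYi[of z "real n"]]])
          (auto intro!: continuous_intros)
    qed auto
    moreover have "(\<Union>n\<in>UNIV. {..<real n}) = (UNIV :: real set)" using reals_Archimedean2 by auto
    ultimately show ?thesis by simp
  qed
  define T where "T z = Bcontfun (\<lambda>t. exp (- (k * max 0 t)) *\<^sub>R I z t)" for z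
  have T: "apply_bcontfun (T z) t = exp (- (k * max 0 t)) *\<^sub>R I z t" for z t
  proof -
    define C where "C = norm (F 0) + K * norm z"
    have C: "0 \<le> C" using assms(1) by (simp add: C_def)
    have "norm (F (Y z s)) \<le> C * exp (k * s)" if "0 \<le> s" for s
    proof -
      have "norm (F (Y z s)) \<le> norm (F 0) + K * norm (Y z s)"
        using F[of "Y z s" 0] norm_triangle_sub[of "F (Y z s)" "F 0"] by simp
      also have "K * norm (Y z s) \<le> K * (norm z * exp (k * s))"
        using normY assms(1) by (intro mult_left_mono) auto
      also have "norm (F 0) \<le> norm (F 0) * exp (k * s)"
        using that k by (simp add: mult_le_cancel_left1)
      finally show ?thesis by (simp add: C_def algebra_simps)
    qed
    then have "norm (I z t) \<le> C / k * exp (k * max 0 t)" for t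
      unfolding I_def using k C FYc by (intro norm_integral_le_exp) auto
    then have "exp (- (k * max 0 t)) * norm (I z t) \<le> exp (- (k * max 0 t)) * (C / k * exp (k * max 0 t))" for t
      by (intro mult_left_mono) auto
    then have "norm (exp (- (k * max 0 t)) *\<^sub>R I z t) \<le> C / k" for t
      by (simp add: exp_minus field_simps)
    then have "(\<lambda>t. exp (- (k * max 0 t)) *\<^sub>R I z t) \<in> bcontfun"
      by (intro bcontfun_normI continuous_intros Ic)
    then show ?thesis unfolding T_def by (simp add: Bcontfun_inverse)
  qed
  have contr: "dist (T z) (T z') \<le> 1/2 * dist z z'" for z z'
    unfolding dist_norm
  proof (rule norm_bound)
    fix t
    have "norm (F (Y z s) - F (Y z' s)) \<le> (K * norm (z - z')) * exp (k * s)" for s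
    proof -
      have "Y z s - Y z' s = Y (z - z') s" by (simp add: Y_def scaleR_diff_right)
      then have "norm (F (Y z s) - F (Y z' s)) \<le> K * norm (Y (z - z') s)" using F by metis
      also have "\<dots> \<le> K * (norm (z - z') * exp (k * s))" using normY assms(1) by (intro mult_left_mono) auto
      finally show ?thesis by (simp add: mult_ac)
    qed
    then have "norm (integral {0..max 0 t} (\<lambda>s. F (Y z s) - F (Y z' s))) \<le> (K * norm (z - z')) / k * exp (k * max 0 t)"
      using k FYc assms(1) by (intro norm_integral_le_exp continuous_intros) auto
    also have "integral {0..max 0 t} (\<lambda>s. F (Y z s) - F (Y z' s)) = I z t - I z' t"
      unfolding I_def by (intro Henstock_Kurzweil_Integration.integral_diff FYi)
    also have "(K * norm (z - z')) / k = 1/2 * norm (z - z')" using assms(1) by (simp add: k_def)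
    finally have "exp (- (k * max 0 t)) * norm (I z t - I z' t)
        \<le> exp (- (k * max 0 t)) * (1/2 * norm (z - z') * exp (k * max 0 t))"
      by (intro mult_left_mono) auto
    also have "\<dots> = 1/2 * norm (z - z')" by (simp add: exp_minus)
    finally show "norm (apply_bcontfun (T z - T z') t) \<le> 1/2 * norm (z - z')"
      by (simp add: T scaleR_diff_right[symmetric])
  qed
  obtain z where z: "T z = z"
    using banach_fix_type[of "1/2" T] contr by auto
  have Yeq: "Y z t = integral {0..t} (\<lambda>s. F (Y z s))" if "0 \<le> t" for t
  proof -
    have "Y z t = exp (k * t) *\<^sub>R (exp (- (k * max 0 t)) *\<^sub>R I z t)"
      unfolding Y_def T[symmetric] z ..
    then show ?thesis using that by (simp add: I_def exp_minus)
  qed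
  have Yc: "continuous_on UNIV (Y z)"
    unfolding Y_def by (intro continuous_intros continuous_on_apply_bcontfun)
  show ?thesis by (intro exI[of _ "Y z"] conjI allI impI Yeq Yc)
qed

text \<open>Up to the first time at which \<open>f\<close> reaches \<open>M\<close> the function is nonincreasing, so that its value
  at this time would be at most \<open>f 0 < M\<close>.\<close>

lemma nonincreasing_below_barrier:
  fixes f :: "real \<Rightarrow> real"
  assumes f: "continuous_on {0..} f" and "f 0 < M"
    and der: "\<And>t. 0 < t \<Longrightarrow> f t < M \<Longrightarrow> \<exists>y. (f has_real_derivative y) (at t) \<and> y \<le> 0"
    and "0 \<le> t"
  shows "f t \<le> f 0"
proof -
  have mono: "f b \<le> f 0" if "0 \<le> b" "\<And>s. 0 < s \<Longrightarrow> s < b \<Longrightarrow> f s < M" for b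
  proof (cases "b = 0")
    case False
    then show ?thesis
      using that der f by (intro DERIV_nonpos_imp_decreasing_open[of 0 b f]) (auto elim: continuous_on_subset)
  qed simp
  have "f s < M" if "0 \<le> s" for s
  proof (rule ccontr)
    assume "\<not> f s < M"
    define S where "S = {x \<in> {0..s}. M \<le> f x}"
    have fs: "continuous_on {0..s} f" using f by (rule continuous_on_subset) auto
    have "S = {0..s} \<inter> f -` {M..}" by (auto simp: S_def)
    then have "compact S"
      using continuous_on_closed_vimage[of "{0..s}" f, THEN iffD1, OF _ fs] compact_Icc[of 0 s]
      by (metis Int_commute closed_atLeast closed_atLeastAtMost compact_Int_closed inf.right_idem)
    moreover have "S \<noteq> {}" using \<open>\<not> f s < M\<close> that by (auto simp: S_def)
    ultimately obtain s0 where s0: "s0 \<in> S" "\<And>x. x \<in> S \<Longrightarrow> s0 \<le> x"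
      using compact_attains_inf[of S] by blast
    have "f x < M" if "0 < x" "x < s0" for x
      using s0(2)[of x] s0(1) that by (force simp: S_def)
    then have "f s0 \<le> f 0" using s0(1) by (intro mono) (auto simp: S_def)
    then show False using s0(1) \<open>f 0 < M\<close> by (auto simp: S_def)
  qed
  then show ?thesis using \<open>0 \<le> t\<close> by (intro mono) auto
qed

section \<open>Families of functions depending linearly on data\<close>

text \<open>Functions on \<open>{0..L}\<close> that depend linearly on a parameter, with a uniform bound. The closure
  properties of this notion yield the continuity of operators given by explicit formulas without
  estimating these formulas by hand.\<close>

definition linear_family :: "real \<Rightarrow> ('a::real_normed_vector \<Rightarrow> real \<Rightarrow> real) \<Rightarrow> bool" where
  "linear_family L T \<longleftrightarrow>
     (\<forall>y. continuous_on {0..L} (T y)) \<and>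
     (\<forall>x\<in>{0..L}. \<forall>y z. T (y + z) x = T y x + T z x) \<and>
     (\<forall>x\<in>{0..L}. \<forall>c y. T (c *\<^sub>R y) x = c * T y x) \<and>
     (\<exists>K\<ge>0. \<forall>x\<in>{0..L}. \<forall>y. \<bar>T y x\<bar> \<le> K * norm y)"

lemma linear_family_continuous: "linear_family L T \<Longrightarrow> continuous_on {0..L} (T y)"
  by (simp add: linear_family_def)

lemma linear_family_const:
  assumes "bounded_linear f"
  shows "linear_family L (\<lambda>y x. f y)"
proof -
  obtain K where "K \<ge> 0" "\<And>y. norm (f y) \<le> norm y * K"
    using bounded_linear.nonneg_bounded[OF assms] by blast
  then show ?thesis
    unfolding linear_family_def
    by (auto simp: linear_simps[OF assms] mult.commute intro!: exI[of _ K])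
qed

lemma linear_family_add:
  assumes "linear_family L S" "linear_family L T"
  shows "linear_family L (\<lambda>y x. S y x + T y x)"
proof -
  obtain K K' where K: "K \<ge> 0" "\<forall>x\<in>{0..L}. \<forall>y. \<bar>S y x\<bar> \<le> K * norm y"
    "K' \<ge> 0" "\<forall>x\<in>{0..L}. \<forall>y. \<bar>T y x\<bar> \<le> K' * norm y"
    using assms unfolding linear_family_def by blast
  then have "\<bar>S y x + T y x\<bar> \<le> (K + K') * norm y" if "x \<in> {0..L}" for x y
    unfolding distrib_right using that by (meson abs_triangle_ineq add_mono order_trans)
  moreover have "0 \<le> K + K'" using K by simp
  ultimately have "\<exists>K\<ge>0. \<forall>x\<in>{0..L}. \<forall>y. \<bar>S y x + T y x\<bar> \<le> K * norm y" by blast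
  then show ?thesis
    using assms unfolding linear_family_def by (auto intro!: continuous_intros simp: algebra_simps)
qed

lemma linear_family_mult:
  assumes k: "continuous_on {0..L} k" and T: "linear_family L T"
  shows "linear_family L (\<lambda>y x. k x * T y x)"
proof -
  have "bounded (k ` {0..L})" using k by (intro compact_imp_bounded compact_continuous_image) auto
  then obtain B where B: "\<And>x. x \<in> {0..L} \<Longrightarrow> \<bar>k x\<bar> \<le> B" unfolding bounded_iff by fastforce
  obtain K where K: "K \<ge> 0" "\<And>x y. x \<in> {0..L} \<Longrightarrow> \<bar>T y x\<bar> \<le> K * norm y"
    using T unfolding linear_family_def by blast
  have "\<bar>k x * T y x\<bar> \<le> \<bar>B\<bar> * K * norm y" if "x \<in> {0..L}" for x y
  proof -
    have "\<bar>k x * T y x\<bar> \<le> \<bar>B\<bar> * (K * norm y)"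
      unfolding abs_mult using B[OF that] K(2)[OF that] by (intro mult_mono) auto
    then show ?thesis by (simp add: mult.assoc)
  qed
  moreover have "0 \<le> \<bar>B\<bar> * K" using K(1) by simp
  ultimately have "\<exists>K\<ge>0. \<forall>x\<in>{0..L}. \<forall>y. \<bar>k x * T y x\<bar> \<le> K * norm y" by blast
  then show ?thesis
    using T k unfolding linear_family_def by (auto intro!: continuous_intros simp: algebra_simps)
qed

lemma linear_family_cmult: "linear_family L T \<Longrightarrow> linear_family L (\<lambda>y x. c * T y x)"
  by (rule linear_family_mult) auto

lemma linear_family_diff:
  assumes "linear_family L S" "linear_family L T"
  shows "linear_family L (\<lambda>y x. S y x - T y x)"
  using linear_family_add[OF assms(1) linear_family_cmult[OF assms(2), of "-1"]] by simp

lemma linear_family_integral: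
  assumes "0 < L" and T: "linear_family L T"
  shows "linear_family L (\<lambda>y x. integral {0..x} (T y))"
proof -
  obtain K where K: "K \<ge> 0" "\<And>x y. x \<in> {0..L} \<Longrightarrow> \<bar>T y x\<bar> \<le> K * norm y"
    using T unfolding linear_family_def by blast
  have Tc: "continuous_on {0..L} (T y)" for y using T unfolding linear_family_def by blast
  have Ti: "T y integrable_on {0..x}" if "x \<in> {0..L}" for x y
    using Tc[of y] that by (intro integrable_continuous_real) (auto elim: continuous_on_subset)
  have add: "integral {0..x} (T (y + z)) = integral {0..x} (T y) + integral {0..x} (T z)"
    if "x \<in> {0..L}" for x y z
  proof -
    have "integral {0..x} (T (y + z)) = integral {0..x} (\<lambda>s. T y s + T z s)"
      using that T by (intro integral_cong) (auto simp: linear_family_def)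
    then show ?thesis using Ti[OF that] by (simp add: Henstock_Kurzweil_Integration.integral_add)
  qed
  have scale: "integral {0..x} (T (c *\<^sub>R y)) = c * integral {0..x} (T y)" if "x \<in> {0..L}" for x y c
  proof -
    have "integral {0..x} (T (c *\<^sub>R y)) = integral {0..x} (\<lambda>s. c * T y s)"
      using that T by (intro integral_cong) (auto simp: linear_family_def)
    then show ?thesis by simp
  qed
  have bound: "\<bar>integral {0..x} (T y)\<bar> \<le> L * K * norm y" if "x \<in> {0..L}" for x y
  proof -
    have "norm (integral {0..x} (T y)) \<le> (K * norm y) * (x - 0)"
      using that K Tc[of y] by (intro integral_bound) (auto elim: continuous_on_subset)
    also have "\<dots> \<le> (K * norm y) * L" using that K by (intro mult_left_mono) auto
    finally show ?thesis by (simp add: mult_ac)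
  qed
  have "0 \<le> L * K" using assms K by simp
  with bound have "\<exists>K\<ge>0. \<forall>x\<in>{0..L}. \<forall>y. \<bar>integral {0..x} (T y)\<bar> \<le> K * norm y" by blast
  then show ?thesis
    unfolding linear_family_def using assms
    by (auto simp: add scale intro!: indefinite_integral_continuous_1 Ti)
qed

lemma linear_family_eval:
  assumes T: "linear_family L T" and x: "x \<in> {0..L}"
  shows "bounded_linear (\<lambda>y. T y x)"
proof -
  obtain K where K: "\<And>x y. x \<in> {0..L} \<Longrightarrow> \<bar>T y x\<bar> \<le> K * norm y"
    using T unfolding linear_family_def by blast
  show ?thesis
    using T x K by (intro bounded_linear_intro[where K = K]) (auto simp: linear_family_def mult.commute)
qed

section \<open>Continuous functions on a star-shaped network\<close>

text \<open>A point of the network is a pair of an edge and a position. A metric for the discrete topology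
  of the edges makes the pairs a metric space, and the bounded continuous functions on it a Banach
  space.\<close>

instantiation nat :: metric_space
begin

definition dist_nat :: "nat \<Rightarrow> nat \<Rightarrow> real" where
  "dist_nat m n = \<bar>real m - real n\<bar>"

definition uniformity_nat :: "(nat \<times> nat) filter" where
  "uniformity_nat = (INF e\<in>{0<..}. principal {(x, y). dist x y < e})"

instance
proof
  show "uniformity = (INF e\<in>{0<..}. principal {(x :: nat, y). dist x y < e})"
    by (rule uniformity_nat_def)
  show "open U = (\<forall>x\<in>U. eventually (\<lambda>(x', y). x' = x \<longrightarrow> y \<in> U) uniformity)" for U :: "nat set"
  proof -
    have "eventually (\<lambda>(x', y). x' = x \<longrightarrow> y \<in> U) uniformity" if "x \<in> U" for x
    proof -
      have "{(x', y). x' = x \<longrightarrow> y \<in> U} \<supseteq> {(m, n). dist m n < 1}"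
      proof (clarify)
        fix n assume "dist x n < 1"
        then have "x = n" unfolding dist_nat_def by linarith
        then show "n \<in> U" using that by simp
      qed
      then have "eventually (\<lambda>(x', y). x' = x \<longrightarrow> y \<in> U) (principal {(m :: nat, n). dist m n < 1})"
        by (auto simp: eventually_principal)
      then show ?thesis
        unfolding uniformity_nat_def by (intro eventually_INF1[of 1]) auto
    qed
    then show ?thesis by (simp add: open_discrete)
  qed
qed (auto simp: dist_nat_def)

end

instance bcontfun :: (metric_space, banach) banach ..

type_synonym net_state = "(nat \<times> real) \<Rightarrow>\<^sub>C real"

lemma abs_le_norm_state: "\<bar>apply_bcontfun f z\<bar> \<le> norm f" for f :: net_state
  using norm_bounded[of f z] by simp

lemma continuous_on_state_edge: "continuous_on S (\<lambda>x. apply_bcontfun f (j, x))" for f :: net_state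
  by (rule continuous_on_compose2[OF continuous_on_apply_bcontfun[of UNIV f]])
    (auto intro!: continuous_intros)

lemma linear_family_state:
  assumes "bounded_linear f"
  shows "linear_family L (\<lambda>y x. apply_bcontfun (f y :: net_state) (j, x))"
proof -
  obtain K where K: "K \<ge> 0" "\<And>y. norm (f y) \<le> norm y * K"
    using bounded_linear.nonneg_bounded[OF assms] by blast
  have "\<bar>apply_bcontfun (f y) (j, x)\<bar> \<le> K * norm y" for x y
    using abs_le_norm_state[of "f y" "(j, x)"] K(2)[of y] by (simp add: mult.commute)
  with K(1) show ?thesis
    unfolding linear_family_def
    by (auto simp: linear_simps[OF assms] intro!: exI[of _ K] continuous_on_state_edge)
qed

locale star_network =
  fixes N :: nat and l :: "nat \<Rightarrow> real"
  assumes N: "N \<ge> 1" and l: "\<And>j. j \<in> {1..N} \<Longrightarrow> l j > 0"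
begin

definition net_continuous :: "net_fun \<Rightarrow> bool" where
  "net_continuous u \<longleftrightarrow> (\<forall>j\<in>{1..N}. continuous_on {0..l j} (u j))"

text \<open>Clamping positions to the edge turns every family that is continuous on the closed edges into a
  bounded continuous function. Families that agree on the network have the same lift.\<close>

definition lift :: "net_fun \<Rightarrow> net_state" where
  "lift u = Bcontfun (\<lambda>(j, x). if j \<in> {1..N} then u j (max 0 (min (l j) x)) else 0)"

lemma lift_apply:
  assumes "net_continuous u"
  shows "apply_bcontfun (lift u) (j, x) = (if j \<in> {1..N} then u j (max 0 (min (l j) x)) else 0)"
proof -
  let ?f = "\<lambda>(j, x). if j \<in> {1..N} then u j (max 0 (min (l j) x)) else 0"
  have "continuous_on (\<Union>j\<in>UNIV. {j} \<times> UNIV) ?f"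
  proof (rule continuous_on_open_UN)
    fix j :: nat
    show "open ({j} \<times> (UNIV :: real set))" by (intro open_Times open_discrete) auto
    show "continuous_on ({j} \<times> UNIV) ?f"
    proof (cases "j \<in> {1..N}")
      case True
      have "continuous_on ({j} \<times> UNIV) (\<lambda>z. u j (max 0 (min (l j) (snd z))))"
        using assms True l[OF True] unfolding net_continuous_def
        by (intro continuous_on_compose2[where f = "\<lambda>z. max 0 (min (l j) (snd z))" and g = "u j" and t = "{0..l j}"])
          (auto intro!: continuous_intros)
      then show ?thesis by (rule continuous_on_eq) (use True in auto)
    next
      case False
      have "continuous_on ({j} \<times> UNIV) (\<lambda>z :: nat \<times> real. 0 :: real)" by auto
      then show ?thesis by (rule continuous_on_eq) (use False in auto)
    qed
  qed
  moreover have "(\<Union>j\<in>UNIV. {j} \<times> UNIV) = (UNIV :: (nat \<times> real) set)" by auto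
  ultimately have c: "continuous_on UNIV ?f" by simp
  have "bounded (\<Union>j\<in>{1..N}. u j ` {0..l j})"
    using assms unfolding net_continuous_def
    by (intro bounded_UN) (auto intro!: compact_imp_bounded compact_continuous_image)
  then obtain B where "\<And>j x. j \<in> {1..N} \<Longrightarrow> x \<in> {0..l j} \<Longrightarrow> norm (u j x) \<le> B"
    unfolding bounded_iff by blast
  then have "norm (?f z) \<le> \<bar>B\<bar>" for z
    using l[of "fst z"] by (auto split: prod.splits simp: abs_le_iff) (smt (verit) atLeastAtMost_iff real_norm_def)+
  then have "?f \<in> bcontfun" by (rule bcontfun_normI[OF c])
  then show ?thesis unfolding lift_def by (simp add: Bcontfun_inverse)
qed

lemma lift_eq [simp]:
  assumes "net_continuous u" "j \<in> {1..N}" "x \<in> {0..l j}"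
  shows "apply_bcontfun (lift u) (j, x) = u j x"
proof -
  have "max 0 (min (l j) x) = x" using assms(3) by auto
  then show ?thesis using assms by (simp add: lift_apply)
qed

lemma norm_lift_diff_le:
  assumes "net_continuous u" "net_continuous v"
    and "\<And>j x. j \<in> {1..N} \<Longrightarrow> x \<in> {0..l j} \<Longrightarrow> \<bar>u j x - v j x\<bar> \<le> B" and "0 \<le> B"
  shows "norm (lift u - lift v) \<le> B"
proof (rule norm_bound)
  fix z :: "nat \<times> real"
  obtain j x where z: "z = (j, x)" by (cases z)
  show "norm (apply_bcontfun (lift u - lift v) z) \<le> B"
    using assms(3)[of j "max 0 (min (l j) x)"] \<open>0 \<le> B\<close> l[of j]
    by (auto simp: z lift_apply[OF assms(1)] lift_apply[OF assms(2)])
qed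

lemma bounded_linear_lift:
  assumes T: "\<And>j. j \<in> {1..N} \<Longrightarrow> linear_family (l j) (T j)"
  shows "bounded_linear (\<lambda>y. lift (\<lambda>j. T j y))"
proof -
  have c: "net_continuous (\<lambda>j. T j y)" for y
    using T unfolding net_continuous_def linear_family_def by auto
  have cl: "max 0 (min (l j) x) \<in> {0..l j}" if "j \<in> {1..N}" for j x using l[OF that] by auto
  have "\<forall>j\<in>{1..N}. \<exists>K\<ge>0. \<forall>x\<in>{0..l j}. \<forall>y. \<bar>T j y x\<bar> \<le> K * norm y"
    using T unfolding linear_family_def by blast
  then obtain K where K: "\<And>j. j \<in> {1..N} \<Longrightarrow> K j \<ge> 0"
    "\<And>j x y. j \<in> {1..N} \<Longrightarrow> x \<in> {0..l j} \<Longrightarrow> \<bar>T j y x\<bar> \<le> K j * norm y"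
    by metis
  show ?thesis
  proof (rule bounded_linear_intro[where K = "\<Sum>j=1..N. K j"])
    show "lift (\<lambda>j. T j (y + z)) = lift (\<lambda>j. T j y) + lift (\<lambda>j. T j z)" for y z
      by (rule bcontfun_eqI) (use T cl in \<open>auto simp: lift_apply[OF c] linear_family_def split: prod.splits\<close>)
    show "lift (\<lambda>j. T j (r *\<^sub>R y)) = r *\<^sub>R lift (\<lambda>j. T j y)" for r y
      by (rule bcontfun_eqI) (use T cl in \<open>auto simp: lift_apply[OF c] linear_family_def split: prod.splits\<close>)
    show "norm (lift (\<lambda>j. T j y)) \<le> norm y * (\<Sum>j=1..N. K j)" for y
    proof (rule norm_bound)
      fix z :: "nat \<times> real"
      obtain j x where z: "z = (j, x)" by (cases z)
      show "norm (apply_bcontfun (lift (\<lambda>j. T j y)) z) \<le> norm y * (\<Sum>j=1..N. K j)"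
      proof (cases "j \<in> {1..N}")
        case True
        have "\<bar>T j y (max 0 (min (l j) x))\<bar> \<le> K j * norm y" using K(2) cl True by blast
        also have "\<dots> \<le> (\<Sum>j=1..N. K j) * norm y"
          using True K(1) by (intro mult_right_mono member_le_sum) auto
        finally show ?thesis using True by (simp add: z lift_apply[OF c] mult.commute)
      next
        case False
        then show ?thesis using K(1) by (auto simp: z lift_apply[OF c] intro!: mult_nonneg_nonneg sum_nonneg)
      qed
    qed
  qed
qed

text \<open>The primitive that vanishes at the outer end of every edge. It recovers a function from its
  derivative, which is the state of the evolution.\<close>

definition prim :: "net_state \<Rightarrow> net_state" where
  "prim G = lift (\<lambda>j x. integral {0..x} (\<lambda>s. apply_bcontfun G (j, s))
                        - integral {0..l j} (\<lambda>s. apply_bcontfun G (j, s)))"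

lemma prim_family:
  assumes "j \<in> {1..N}"
  shows "linear_family (l j) (\<lambda>G x. integral {0..x} (\<lambda>s. apply_bcontfun G (j, s))
                        - integral {0..l j} (\<lambda>s. apply_bcontfun G (j, s)))"
proof -
  have F: "linear_family (l j) (\<lambda>G x. integral {0..x} (\<lambda>s. apply_bcontfun G (j, s)))"
    using l[OF assms] by (intro linear_family_integral linear_family_state bounded_linear_ident)
  show ?thesis
    by (intro linear_family_diff F linear_family_const linear_family_eval[OF F]) (use l[OF assms] in auto)
qed

lemma bounded_linear_prim: "bounded_linear prim"
  unfolding prim_def[abs_def] by (rule bounded_linear_lift) (rule prim_family)

lemma prim_apply:
  assumes "j \<in> {1..N}" "x \<in> {0..l j}"
  shows "apply_bcontfun (prim G) (j, x) =
    integral {0..x} (\<lambda>s. apply_bcontfun G (j, s)) - integral {0..l j} (\<lambda>s. apply_bcontfun G (j, s))"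
  unfolding prim_def
  by (rule lift_eq) (use prim_family assms in \<open>auto simp: net_continuous_def linear_family_def\<close>)

lemma prim_end: "j \<in> {1..N} \<Longrightarrow> apply_bcontfun (prim G) (j, l j) = 0"
  using l[of j] by (simp add: prim_apply)

lemma primitive_prim:
  assumes "j \<in> {1..N}"
  shows "primitive (l j) (\<lambda>x. apply_bcontfun (prim G) (j, x)) (\<lambda>x. apply_bcontfun G (j, x))"
  unfolding primitive_def using assms l[OF assms]
  by (auto simp: prim_apply intro!: absolutely_integrable_continuous_real continuous_on_state_edge)

lemma prim_unique:
  assumes "net_continuous v" "j \<in> {1..N}" and "primitive (l j) (v j) (\<lambda>x. apply_bcontfun G (j, x))"
    and "v j (l j) = 0" and "x \<in> {0..l j}"
  shows "apply_bcontfun (prim G) (j, x) = v j x"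
  using primitiveD(2)[OF assms(3), of x] primitiveD(2)[OF assms(3), of "l j"] assms
  by (simp add: prim_apply)


section \<open>The linear elliptic problem on the network\<close>

text \<open>Let \<open>p\<close> be continuous on the edges. The equation \<open>v - v'' = - p'\<close> is the system \<open>v' = w + p\<close>,
  \<open>w' = v\<close> for the value \<open>v\<close> and the flux \<open>w = v' - p\<close>. By variation of constants, on the edge \<open>j\<close>,
  \<open>v x = cosh x * (a + C x) + sinh x * (b - S x)\<close> and
  \<open>w x = sinh x * (a + C x) + cosh x * (b - S x)\<close>, where \<open>C\<close> and \<open>S\<close> are the two moments of \<open>p\<close>
  below, \<open>a = v 0\<close> is common to all edges and \<open>b = w 0\<close>. The condition \<open>v (l j) = 0\<close> expresses \<open>b\<close>
  through \<open>a\<close>, and the prescribed sum \<open>g\<close> of all \<open>v' 0 = b + p 0\<close> then determines \<open>a\<close>. The data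
  of the problem are the pair \<open>y = (p, g)\<close>.\<close>

definition cosh_moment :: "net_state \<Rightarrow> nat \<Rightarrow> real \<Rightarrow> real" where
  "cosh_moment p j x = integral {0..x} (\<lambda>s. cosh s * apply_bcontfun p (j, s))"

definition sinh_moment :: "net_state \<Rightarrow> nat \<Rightarrow> real \<Rightarrow> real" where
  "sinh_moment p j x = integral {0..x} (\<lambda>s. sinh s * apply_bcontfun p (j, s))"

text \<open>The integral of \<open>cosh (l j - s) * p s\<close> over the edge, by the addition theorem: the contribution
  of \<open>p\<close> to the value of \<open>v\<close> at the outer end.\<close>

definition load :: "net_state \<Rightarrow> nat \<Rightarrow> real" where
  "load p j = cosh (l j) * cosh_moment p j (l j) - sinh (l j) * sinh_moment p j (l j)"

definition value_at_node :: "net_state \<times> real \<Rightarrow> real" where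
  "value_at_node y = ((\<Sum>j=1..N. apply_bcontfun (fst y) (j, 0)) - snd y - (\<Sum>j=1..N. load (fst y) j / sinh (l j)))
      / (\<Sum>j=1..N. cosh (l j) / sinh (l j))"

definition flux_at_node :: "net_state \<times> real \<Rightarrow> nat \<Rightarrow> real" where
  "flux_at_node y j = - (value_at_node y * cosh (l j) + load (fst y) j) / sinh (l j)"

definition elliptic_value :: "net_state \<times> real \<Rightarrow> net_fun" where
  "elliptic_value y j x = cosh x * (value_at_node y + cosh_moment (fst y) j x)
                        + sinh x * (flux_at_node y j - sinh_moment (fst y) j x)"

definition elliptic_flux :: "net_state \<times> real \<Rightarrow> net_fun" where
  "elliptic_flux y j x = sinh x * (value_at_node y + cosh_moment (fst y) j x)
                       + cosh x * (flux_at_node y j - sinh_moment (fst y) j x)"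

text \<open>The derivative \<open>v' = w + p\<close> of the solution.\<close>

definition elliptic_slope :: "net_state \<times> real \<Rightarrow> net_state" where
  "elliptic_slope y = lift (\<lambda>j x. elliptic_flux y j x + apply_bcontfun (fst y) (j, x))"

lemma coth_sum_pos: "(\<Sum>j=1..N. cosh (l j) / sinh (l j)) > 0"
  using N l by (intro sum_pos) (auto intro!: divide_pos_pos cosh_real_pos simp: sinh_real_pos_iff)

lemma sinh_length_neq_0: "j \<in> {1..N} \<Longrightarrow> sinh (l j) \<noteq> 0"
  using l[of j] by (simp add: sinh_real_zero_iff)

lemma moment_families:
  assumes "j \<in> {1..N}"
  shows "linear_family (l j) (\<lambda>y :: net_state \<times> real. cosh_moment (fst y) j)"
    "linear_family (l j) (\<lambda>y :: net_state \<times> real. sinh_moment (fst y) j)"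
  unfolding cosh_moment_def[abs_def] sinh_moment_def[abs_def] using l[OF assms]
  by (intro linear_family_integral linear_family_mult linear_family_state bounded_linear_fst
      continuous_intros; simp)+

lemma bounded_linear_load:
  assumes "j \<in> {1..N}"
  shows "bounded_linear (\<lambda>y :: net_state \<times> real. load (fst y) j)"
  unfolding load_def using l[OF assms]
  by (intro bounded_linear_sub bounded_linear_const_mult
      linear_family_eval[OF moment_families(1)[OF assms]] linear_family_eval[OF moment_families(2)[OF assms]]) auto

lemma bounded_linear_value_at_node: "bounded_linear value_at_node"
proof -
  have "bounded_linear (\<lambda>y :: net_state \<times> real. apply_bcontfun (fst y) (j, 0))" for j
    using linear_family_eval[OF linear_family_state[OF bounded_linear_fst, of 1 j], of 0] by auto
  then show ?thesis
    unfolding value_at_node_def[abs_def] divide_inverse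
    by (intro bounded_linear_sub bounded_linear_mult_const bounded_linear_sum bounded_linear_load
        bounded_linear_snd)
qed

lemma bounded_linear_flux_at_node: "j \<in> {1..N} \<Longrightarrow> bounded_linear (\<lambda>y. flux_at_node y j)"
  unfolding flux_at_node_def divide_inverse
  by (intro bounded_linear_minus bounded_linear_mult_const bounded_linear_add bounded_linear_load
      bounded_linear_value_at_node)

lemma elliptic_slope_family:
  assumes "j \<in> {1..N}"
  shows "linear_family (l j) (\<lambda>y x. elliptic_flux y j x + apply_bcontfun (fst y) (j, x))"
  unfolding elliptic_flux_def
  by (intro linear_family_add linear_family_mult linear_family_diff linear_family_const
      moment_families[OF assms] bounded_linear_value_at_node bounded_linear_flux_at_node[OF assms]
      linear_family_state bounded_linear_fst continuous_intros)

lemma bounded_linear_elliptic_slope: "bounded_linear elliptic_slope"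
  unfolding elliptic_slope_def[abs_def] by (rule bounded_linear_lift) (rule elliptic_slope_family)

lemma moment_derivatives:
  assumes "x \<in> {0..l j}"
  shows "(cosh_moment p j has_real_derivative cosh x * apply_bcontfun p (j, x)) (at x within {0..l j})"
    "(sinh_moment p j has_real_derivative sinh x * apply_bcontfun p (j, x)) (at x within {0..l j})"
  unfolding cosh_moment_def[abs_def] sinh_moment_def[abs_def]
  by (rule integral_has_real_derivative; use assms in \<open>auto intro!: continuous_intros continuous_on_state_edge\<close>)+

lemma elliptic_derivatives:
  assumes "x \<in> {0..l j}"
  shows "(elliptic_value y j has_real_derivative elliptic_flux y j x + apply_bcontfun (fst y) (j, x))
           (at x within {0..l j})"
    "(elliptic_flux y j has_real_derivative elliptic_value y j x) (at x within {0..l j})"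
proof -
  note d = moment_derivatives[OF assms]
  have D: "(elliptic_value y j has_real_derivative
      (cosh x * (cosh x * apply_bcontfun (fst y) (j, x)) + sinh x * (value_at_node y + cosh_moment (fst y) j x))
      + (sinh x * (0 - sinh x * apply_bcontfun (fst y) (j, x)) + cosh x * (flux_at_node y j - sinh_moment (fst y) j x)))
     (at x within {0..l j})"
    unfolding elliptic_value_def[abs_def]
    by (rule derivative_eq_intros d refl | simp)+
  have eq: "cosh x * (cosh x * c) + sinh x * a + (sinh x * (0 - sinh x * c) + cosh x * b) = sinh x * a + cosh x * b + c"
    for a b c :: real
  proof -
    have "cosh x * (cosh x * c) - sinh x * (sinh x * c) = c"
      using hyperbolic_pythagoras[of x] by (simp add: power2_eq_square algebra_simps)
    then show ?thesis by (simp add: algebra_simps)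
  qed
  show "(elliptic_value y j has_real_derivative elliptic_flux y j x + apply_bcontfun (fst y) (j, x))
           (at x within {0..l j})"
    using D unfolding elliptic_flux_def eq .
  have "(elliptic_flux y j has_real_derivative
      (sinh x * (cosh x * apply_bcontfun (fst y) (j, x)) + cosh x * (value_at_node y + cosh_moment (fst y) j x))
      + (cosh x * (0 - sinh x * apply_bcontfun (fst y) (j, x)) + sinh x * (flux_at_node y j - sinh_moment (fst y) j x)))
     (at x within {0..l j})"
    unfolding elliptic_flux_def[abs_def]
    by (rule derivative_eq_intros d refl | simp)+
  then show "(elliptic_flux y j has_real_derivative elliptic_value y j x) (at x within {0..l j})"
    unfolding elliptic_value_def by (simp add: algebra_simps)
qed

lemma elliptic_slope_apply:
  assumes "j \<in> {1..N}" "x \<in> {0..l j}"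
  shows "apply_bcontfun (elliptic_slope y) (j, x) = elliptic_flux y j x + apply_bcontfun (fst y) (j, x)"
  unfolding elliptic_slope_def
  using linear_family_continuous[OF elliptic_slope_family] assms
  by (intro lift_eq) (auto simp: net_continuous_def)

lemma prim_elliptic_slope:
  assumes j: "j \<in> {1..N}" and x: "x \<in> {0..l j}"
  shows "apply_bcontfun (prim (elliptic_slope y)) (j, x) = elliptic_value y j x"
proof (rule prim_unique[OF _ j _ _ x])
  show "net_continuous (elliptic_value y)"
    unfolding net_continuous_def
    by (auto intro!: DERIV_continuous_on elliptic_derivatives)
  show "primitive (l j) (elliptic_value y j) (\<lambda>x. apply_bcontfun (elliptic_slope y) (j, x))"
    by (intro primitive_has_vector_derivative continuous_on_state_edge)
      (use elliptic_derivatives(1) elliptic_slope_apply[OF j] in auto)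
  show "elliptic_value y j (l j) = 0"
    unfolding elliptic_value_def flux_at_node_def load_def using sinh_length_neq_0[OF j]
    by (simp add: field_simps)
qed

lemma elliptic_value_node: "elliptic_value y j 0 = value_at_node y"
  by (simp add: elliptic_value_def cosh_moment_def)

lemma sum_elliptic_slope_node: "(\<Sum>j=1..N. apply_bcontfun (elliptic_slope y) (j, 0)) = snd y"
proof -
  let ?D = "\<Sum>j=1..N. cosh (l j) / sinh (l j)"
  have "(\<Sum>j=1..N. apply_bcontfun (elliptic_slope y) (j, 0))
      = (\<Sum>j=1..N. apply_bcontfun (fst y) (j, 0) - value_at_node y * (cosh (l j) / sinh (l j)) - load (fst y) j / sinh (l j))"
  proof (intro sum.cong refl)
    fix j assume j: "j \<in> {1..N}"
    have "apply_bcontfun (elliptic_slope y) (j, 0) = flux_at_node y j + apply_bcontfun (fst y) (j, 0)"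
      using l[OF j] by (subst elliptic_slope_apply[OF j]) (auto simp: elliptic_flux_def sinh_moment_def)
    also have "flux_at_node y j = - (value_at_node y * (cosh (l j) / sinh (l j))) - load (fst y) j / sinh (l j)"
      unfolding flux_at_node_def by (simp add: diff_divide_distrib)
    finally show "apply_bcontfun (elliptic_slope y) (j, 0)
      = apply_bcontfun (fst y) (j, 0) - value_at_node y * (cosh (l j) / sinh (l j)) - load (fst y) j / sinh (l j)" by simp
  qed
  also have "\<dots> = (\<Sum>j=1..N. apply_bcontfun (fst y) (j, 0)) - value_at_node y * ?D - (\<Sum>j=1..N. load (fst y) j / sinh (l j))"
    by (simp add: sum_subtractf sum_distrib_left)
  also have "value_at_node y * ?D = (\<Sum>j=1..N. apply_bcontfun (fst y) (j, 0)) - snd y - (\<Sum>j=1..N. load (fst y) j / sinh (l j))"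
    unfolding value_at_node_def using coth_sum_pos by simp
  finally show ?thesis by simp
qed

section \<open>The truncated right-hand side\<close>

definition clip :: "real \<Rightarrow> real \<Rightarrow> real" where
  "clip R s = max (- R) (min R s)"

lemma clip_eq: "\<bar>s\<bar> \<le> R \<Longrightarrow> clip R s = s"
  by (auto simp: clip_def)

text \<open>Both nonlinear data of the elliptic problem are quadratic in a truncated value. In
  \<open>c\<^sup>2 - d\<^sup>2 = (c + d) * (c - d)\<close> the first factor is at most \<open>2 * R\<close> in modulus for truncated \<open>c\<close>, \<open>d\<close>.\<close>

lemma quadratic_clip_Lipschitz:
  assumes "0 \<le> R"
  shows "\<bar>(a * clip R s + b * (clip R s)\<^sup>2) - (a * clip R t + b * (clip R t)\<^sup>2)\<bar>
      \<le> (\<bar>a\<bar> + 2 * \<bar>b\<bar> * R) * \<bar>s - t\<bar>"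
proof -
  define c d where "c = clip R s" and "d = clip R t"
  have cd: "\<bar>c - d\<bar> \<le> \<bar>s - t\<bar>" "\<bar>c + d\<bar> \<le> 2 * R"
    using assms unfolding c_def d_def clip_def by (auto simp: max_def min_def)
  have "(a * c + b * c\<^sup>2) - (a * d + b * d\<^sup>2) = (a + b * (c + d)) * (c - d)"
    by (simp add: power2_eq_square algebra_simps)
  moreover have "\<bar>a + b * (c + d)\<bar> \<le> \<bar>a\<bar> + \<bar>b\<bar> * (2 * R)"
    using cd(2) by (intro order_trans[OF abs_triangle_ineq] add_mono) (auto simp: abs_mult intro!: mult_left_mono)
  ultimately have "\<bar>(a * c + b * c\<^sup>2) - (a * d + b * d\<^sup>2)\<bar> \<le> (\<bar>a\<bar> + \<bar>b\<bar> * (2 * R)) * \<bar>s - t\<bar>"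
    using cd(1) assms by (simp add: abs_mult) (intro mult_mono; simp)
  then show ?thesis unfolding c_def d_def by (simp add: mult_ac)
qed

text \<open>The function \<open>p = u + u\<^sup>2/2\<close> for truncated \<open>u\<close>, in the form of \<open>quadratic_clip_Lipschitz\<close>.\<close>

definition edge_data :: "real \<Rightarrow> net_state \<Rightarrow> net_state" where
  "edge_data R u = lift (\<lambda>j x. 1 * clip R (apply_bcontfun u (j, x)) + 1/2 * (clip R (apply_bcontfun u (j, x)))\<^sup>2)"

definition node_data :: "real \<Rightarrow> real \<Rightarrow> net_state \<Rightarrow> real" where
  "node_data \<alpha> R u = \<alpha> * clip R (apply_bcontfun u (1, 0)) + real N / 3 * (clip R (apply_bcontfun u (1, 0)))\<^sup>2"

text \<open>The right-hand side of the evolution: the space derivative of the time derivative of \<open>u\<close>.\<close>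

definition rhs :: "real \<Rightarrow> real \<Rightarrow> net_state \<Rightarrow> net_state" where
  "rhs \<alpha> R u = elliptic_slope (edge_data R u, node_data \<alpha> R u)"

lemma net_continuous_edge_data:
  "net_continuous (\<lambda>j x. 1 * clip R (apply_bcontfun u (j, x)) + 1/2 * (clip R (apply_bcontfun u (j, x)))\<^sup>2)"
  unfolding net_continuous_def clip_def by (auto intro!: continuous_intros continuous_on_state_edge)

lemma rhs_Lipschitz:
  assumes "0 \<le> R"
  shows "\<exists>K>0. \<forall>u v. norm (rhs \<alpha> R u - rhs \<alpha> R v) \<le> K * norm (u - v)"
proof -
  obtain B where B: "B \<ge> 0" "\<And>y. norm (elliptic_slope y) \<le> norm y * B"
    using bounded_linear.nonneg_bounded[OF bounded_linear_elliptic_slope] by blast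
  define K1 K2 where "K1 = 1 + R" and "K2 = \<bar>\<alpha>\<bar> + 2 * (real N / 3) * R"
  have K: "K1 \<ge> 0" "K2 \<ge> 0" using assms by (simp_all add: K1_def K2_def)
  have pt: "\<bar>apply_bcontfun u z - apply_bcontfun v z\<bar> \<le> norm (u - v)" for u v :: net_state and z
    using abs_le_norm_state[of "u - v" z] by simp
  have "norm (rhs \<alpha> R u - rhs \<alpha> R v) \<le> ((K1 + K2) * B + 1) * norm (u - v)" for u v
  proof -
    have "norm (edge_data R u - edge_data R v) \<le> K1 * norm (u - v)"
      unfolding edge_data_def
    proof (intro norm_lift_diff_le net_continuous_edge_data)
      fix j x
      show "\<bar>1 * clip R (apply_bcontfun u (j, x)) + 1/2 * (clip R (apply_bcontfun u (j, x)))\<^sup>2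
         - (1 * clip R (apply_bcontfun v (j, x)) + 1/2 * (clip R (apply_bcontfun v (j, x)))\<^sup>2)\<bar> \<le> K1 * norm (u - v)"
        by (rule order_trans[OF quadratic_clip_Lipschitz[OF assms]])
          (use pt K in \<open>auto simp: K1_def intro!: mult_left_mono\<close>)
    qed (use K in auto)
    moreover have "\<bar>node_data \<alpha> R u - node_data \<alpha> R v\<bar> \<le> K2 * norm (u - v)"
      unfolding node_data_def
      by (rule order_trans[OF quadratic_clip_Lipschitz[OF assms]])
        (use pt K in \<open>auto simp: K2_def intro!: mult_left_mono\<close>)
    ultimately have "norm ((edge_data R u, node_data \<alpha> R u) - (edge_data R v, node_data \<alpha> R v)) \<le> (K1 + K2) * norm (u - v)"
      using norm_Pair_le[of "edge_data R u - edge_data R v" "node_data \<alpha> R u - node_data \<alpha> R v"]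
      by (simp add: distrib_right)
    then have "norm ((edge_data R u, node_data \<alpha> R u) - (edge_data R v, node_data \<alpha> R v)) * B \<le> (K1 + K2) * norm (u - v) * B"
      using B(1) by (rule mult_right_mono)
    with B(2)[of "(edge_data R u, node_data \<alpha> R u) - (edge_data R v, node_data \<alpha> R v)"]
    have "norm (rhs \<alpha> R u - rhs \<alpha> R v) \<le> (K1 + K2) * norm (u - v) * B"
      unfolding rhs_def linear_simps(2)[OF bounded_linear_elliptic_slope, symmetric] by linarith
    also have "\<dots> \<le> ((K1 + K2) * B + 1) * norm (u - v)" by (simp add: algebra_simps)
    finally show ?thesis .
  qed
  moreover have "(K1 + K2) * B + 1 > 0" using K B by (intro add_nonneg_pos) auto
  ultimately show ?thesis by blast
qed

lemma H1eD:
  assumes "u \<in> H1e N l"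
  shows "net_continuous u" "j \<in> {1..N} \<Longrightarrow> u j \<in> H1 (l j)" "j \<in> {1..N} \<Longrightarrow> u j (l j) = 0"
    "j \<in> {1..N} \<Longrightarrow> k \<in> {1..N} \<Longrightarrow> u j 0 = u k 0"
  using assms unfolding H1e_def H1_def net_continuous_def by blast+

lemma prim_rhs_node:
  assumes "j \<in> {1..N}" "k \<in> {1..N}"
  shows "apply_bcontfun (prim (rhs \<alpha> R u)) (j, 0) = apply_bcontfun (prim (rhs \<alpha> R u)) (k, 0)"
  using assms l[OF assms(1)] l[OF assms(2)]
  by (simp add: rhs_def prim_elliptic_slope elliptic_value_node)

lemma prim_in_H1:
  assumes "j \<in> {1..N}"
  shows "(\<lambda>x. apply_bcontfun (prim G) (j, x)) \<in> H1 (l j)"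
  using l[OF assms] primitive_prim[OF assms]
  by (rule primitive_L2_imp_H1) (intro continuous_on_imp_L2 continuous_on_state_edge)

text \<open>The datum \<open>p = u + u\<^sup>2/2\<close> has the weak derivative \<open>u' + u * u'\<close>, so \<open>v' = w + p\<close> is in H1 with
  weak derivative \<open>v + u' + u * u'\<close>.\<close>

lemma elliptic_solution_prim_rhs:
  assumes u: "u \<in> H1e N l" and R: "\<And>j x. j \<in> {1..N} \<Longrightarrow> x \<in> {0..l j} \<Longrightarrow> \<bar>u j x\<bar> \<le> R"
  shows "elliptic_solution N l \<alpha> u (\<lambda>j x. apply_bcontfun (prim (rhs \<alpha> R (lift u))) (j, x))"
proof -
  define y where "y = (edge_data R (lift u), node_data \<alpha> R (lift u))"
  define q where "q = elliptic_slope y"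
  have q: "rhs \<alpha> R (lift u) = q" by (simp add: rhs_def q_def y_def)
  define V where "V = (\<lambda>j x. apply_bcontfun (prim q) (j, x))"
  note uc = H1eD(1)[OF u]
  have edge: "V j \<in> H2 (l j)" "cderiv (l j) (V j) 0 = apply_bcontfun q (j, 0)"
    "AE x in lebesgue_on {0<..<l j}. V j x - wderiv (l j) (cderiv (l j) (V j)) x
          = - wderiv (l j) (u j) x - u j x * wderiv (l j) (u j) x" if j: "j \<in> {1..N}" for j
  proof -
    note lj = l[OF j]
    define u' where "u' = wderiv (l j) (u j)"
    have u': "u' \<in> L2 (l j)" "primitive (l j) (u j) u'"
      unfolding u'_def using H1_primitive[OF lj H1eD(2)[OF u j]] by auto
    have "primitive (l j) (\<lambda>x. u j x + 1/2 * (u j x * u j x)) (\<lambda>x. u' x + 1/2 * (u' x * u j x + u j x * u' x))"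
      using u' by (intro primitive_add primitive_cmult primitive_mult)
    moreover have "primitive (l j) (elliptic_flux y j) (V j)"
      using elliptic_derivatives(2) prim_elliptic_slope[OF j]
      by (intro primitive_has_vector_derivative) (auto simp: V_def q_def intro!: continuous_on_state_edge)
    ultimately have "primitive (l j) (\<lambda>x. elliptic_flux y j x + (u j x + 1/2 * (u j x * u j x)))
         (\<lambda>x. V j x + (u' x + 1/2 * (u' x * u j x + u j x * u' x)))"
      by (rule primitive_add[rotated])
    then have qp: "primitive (l j) (\<lambda>x. apply_bcontfun q (j, x)) (\<lambda>x. V j x + (u' x + u j x * u' x))"
    proof (rule primitive_cong)
      fix x assume x: "x \<in> {0..l j}"
      have "apply_bcontfun (fst y) (j, x) = u j x + 1/2 * (u j x * u j x)"
        unfolding y_def edge_data_def fst_conv lift_eq[OF net_continuous_edge_data j x] lift_eq[OF uc j x]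
          clip_eq[OF R[OF j x]] by (simp add: power2_eq_square)
      then show "elliptic_flux y j x + (u j x + 1/2 * (u j x * u j x)) = apply_bcontfun q (j, x)"
        unfolding q_def elliptic_slope_apply[OF j x] by simp
    qed (simp add: algebra_simps)
    have L2: "(\<lambda>x. V j x + (u' x + u j x * u' x)) \<in> L2 (l j)"
      by (intro L2_add L2_mult_continuous u' primitive_continuous_on[OF u'(2)] continuous_on_imp_L2)
        (simp add: V_def continuous_on_state_edge)
    have qH: "(\<lambda>x. apply_bcontfun q (j, x)) \<in> H1 (l j)"
      by (rule primitive_L2_imp_H1[OF lj qp L2])
    have Vp: "primitive (l j) (V j) (\<lambda>x. apply_bcontfun q (j, x))"
      unfolding V_def by (rule primitive_prim[OF j])
    note V = primitive_H1_imp_H2[OF lj Vp qH]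
    show "V j \<in> H2 (l j)" by (rule V)
    show "cderiv (l j) (V j) 0 = apply_bcontfun q (j, 0)" using V(2) lj by auto
    have "primitive (l j) (cderiv (l j) (V j)) (\<lambda>x. V j x + (u' x + u j x * u' x))"
      by (rule primitive_cong[OF qp]) (use V(2) in auto)
    from wderiv_AE_eq[OF lj this L2]
    show "AE x in lebesgue_on {0<..<l j}. V j x - wderiv (l j) (cderiv (l j) (V j)) x
          = - wderiv (l j) (u j) x - u j x * wderiv (l j) (u j) x"
      unfolding u'_def by eventually_elim simp
  qed
  have u10: "apply_bcontfun (lift u) (1, 0) = u 1 0" using N l[of 1] uc by auto
  have "(\<Sum>j=1..N. cderiv (l j) (V j) 0) = (\<Sum>j=1..N. apply_bcontfun q (j, 0))"
    using edge(2) by (intro sum.cong) auto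
  also have "\<dots> = node_data \<alpha> R (lift u)" unfolding q_def sum_elliptic_slope_node by (simp add: y_def)
  also have "\<dots> = \<alpha> * u 1 0 + real N / 3 * (u 1 0)\<^sup>2"
    unfolding node_data_def u10 using R[of 1 0] N l[of 1] by (simp add: clip_eq)
  finally show ?thesis
    unfolding elliptic_solution_def q V_def[symmetric]
  proof (intro conjI ballI)
    show "V j 0 = V k 0" if "j \<in> {1..N}" "k \<in> {1..N}" for j k
      unfolding V_def q[symmetric] by (rule prim_rhs_node[OF that])
    show "V j (l j) = 0" if "j \<in> {1..N}" for j
      unfolding V_def by (rule prim_end[OF that])
  qed (rule edge | assumption)+
qed


section \<open>The energy space of the network\<close>

text \<open>H1 on every edge, without conditions at the ends. Since \<open>prim G\<close> is continuous at the node only for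
  special \<open>G\<close>, bilinearity of the inner product is needed on this larger space.\<close>

definition H1_edges :: "net_fun set" where
  "H1_edges = {u. \<forall>j\<in>{1..N}. u j \<in> H1 (l j)}"

lemma H1_edges_primitive:
  assumes "u \<in> H1_edges" "j \<in> {1..N}"
  shows "primitive (l j) (u j) (wderiv (l j) (u j))" "wderiv (l j) (u j) \<in> L2 (l j)"
  using assms H1_primitive[OF l[OF assms(2)], of "u j"] by (auto simp: H1_edges_def)

lemma H1_edgesI:
  assumes "\<And>j. j \<in> {1..N} \<Longrightarrow> primitive (l j) (u j) (f j)" "\<And>j. j \<in> {1..N} \<Longrightarrow> f j \<in> L2 (l j)"
  shows "u \<in> H1_edges"
  using primitive_L2_imp_H1[OF l assms] by (auto simp: H1_edges_def)

lemma H1e_iff: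
  "u \<in> H1e N l \<longleftrightarrow> u \<in> H1_edges \<and> (\<forall>j\<in>{1..N}. u j (l j) = 0) \<and> (\<forall>j\<in>{1..N}. \<forall>k\<in>{1..N}. u j 0 = u k 0)"
  by (simp add: H1e_def H1_edges_def)

lemma H1e_inner_eq:
  assumes "\<And>j. j \<in> {1..N} \<Longrightarrow> primitive (l j) (u j) (f j)" "\<And>j. j \<in> {1..N} \<Longrightarrow> f j \<in> L2 (l j)"
    and "\<And>j. j \<in> {1..N} \<Longrightarrow> primitive (l j) (v j) (g j)" "\<And>j. j \<in> {1..N} \<Longrightarrow> g j \<in> L2 (l j)"
  shows "H1e_inner N l u v = (\<Sum>j=1..N. integral {0..l j} (\<lambda>x. u j x * v j x + f j x * g j x))"
  unfolding H1e_inner_def by (intro sum.cong refl LINT_H1_inner l assms)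

lemma H1_inner_integrable:
  assumes "primitive L u f" "f \<in> L2 L" "primitive L v g" "g \<in> L2 L"
  shows "(\<lambda>x. u x * v x + f x * g x) integrable_on {0..L}"
  using assms
  by (intro absolutely_integrable_imp_integrable set_integral_add absolutely_integrable_continuous_real
      continuous_on_mult primitive_continuous_on L2_mult_absolutely_integrable)

lemma H1_edges_add:
  assumes "u \<in> H1_edges" "v \<in> H1_edges"
  shows "(\<lambda>j x. u j x + v j x) \<in> H1_edges"
proof -
  note p = H1_edges_primitive[OF assms(1)] and q = H1_edges_primitive[OF assms(2)]
  show ?thesis by (rule H1_edgesI[OF primitive_add[OF p(1) q(1)] L2_add[OF p(2) q(2)]])
qed

lemma H1_edges_cmult:
  assumes "u \<in> H1_edges"
  shows "(\<lambda>j x. c * u j x) \<in> H1_edges"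
  by (rule H1_edgesI[OF primitive_cmult[OF H1_edges_primitive(1)[OF assms]]
        L2_cmult[OF H1_edges_primitive(2)[OF assms]]])

lemma H1_edges_sum:
  assumes "\<And>i. i \<in> I \<Longrightarrow> u i \<in> H1_edges"
  shows "(\<lambda>j x. \<Sum>i\<in>I. u i j x) \<in> H1_edges"
  by (rule H1_edgesI[OF primitive_sum[OF H1_edges_primitive(1)[OF assms]]
        L2_sum[OF H1_edges_primitive(2)[OF assms]]])

lemma H1eI:
  assumes "u \<in> H1_edges" "\<And>j. j \<in> {1..N} \<Longrightarrow> u j (l j) = 0" "\<And>j. j \<in> {1..N} \<Longrightarrow> u j 0 = u 1 0"
  shows "u \<in> H1e N l"
  unfolding H1e_iff using assms by metis

lemma H1e_edges: "u \<in> H1e N l \<Longrightarrow> u \<in> H1_edges"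
  by (simp add: H1e_iff)

lemma H1e_node: "u \<in> H1e N l \<Longrightarrow> j \<in> {1..N} \<Longrightarrow> u j 0 = u 1 0"
  using H1eD(4)[of u j 1] N by simp

lemma H1e_cmult: "u \<in> H1e N l \<Longrightarrow> (\<lambda>j x. c * u j x) \<in> H1e N l"
  by (rule H1eI) (simp_all only: H1_edges_cmult H1e_edges H1eD(3) H1e_node mult_zero_right)

lemma H1e_sum:
  assumes "\<And>i. i \<in> I \<Longrightarrow> u i \<in> H1e N l"
  shows "(\<lambda>j x. \<Sum>i\<in>I. u i j x) \<in> H1e N l"
proof (rule H1eI)
  show "(\<lambda>j x. \<Sum>i\<in>I. u i j x) \<in> H1_edges" by (intro H1_edges_sum H1e_edges assms)
  show "(\<Sum>i\<in>I. u i j (l j)) = 0" if "j \<in> {1..N}" for j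
    by (intro sum.neutral ballI H1eD(3)[OF assms that])
  show "(\<Sum>i\<in>I. u i j 0) = (\<Sum>i\<in>I. u i 1 0)" if "j \<in> {1..N}" for j
    by (intro sum.cong refl H1e_node[OF assms that])
qed

lemma H1e_diff:
  assumes "u \<in> H1e N l" "v \<in> H1e N l"
  shows "(\<lambda>j x. u j x - v j x) \<in> H1e N l"
proof (rule H1eI)
  have "(\<lambda>j x. u j x + (-1) * v j x) \<in> H1_edges"
    using assms by (intro H1_edges_add H1_edges_cmult H1e_edges)
  then show "(\<lambda>j x. u j x - v j x) \<in> H1_edges" by simp
  show "u j (l j) - v j (l j) = 0" if "j \<in> {1..N}" for j
    using assms[THEN H1eD(3), OF that] by simp
  show "u j 0 - v j 0 = u 1 0 - v 1 0" if "j \<in> {1..N}" for j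
    by (simp only: assms[THEN H1e_node, OF that])
qed

lemma H1e_inner_commute: "H1e_inner N l u v = H1e_inner N l v u"
  by (simp add: H1e_inner_def mult.commute)

lemma H1e_inner_wderiv:
  assumes "u \<in> H1_edges" "v \<in> H1_edges"
  shows "H1e_inner N l u v
    = (\<Sum>j=1..N. integral {0..l j} (\<lambda>x. u j x * v j x + wderiv (l j) (u j) x * wderiv (l j) (v j) x))"
  by (intro H1e_inner_eq H1_edges_primitive[OF assms(1)] H1_edges_primitive[OF assms(2)])

lemma H1e_inner_add:
  assumes "u \<in> H1_edges" "v \<in> H1_edges" "w \<in> H1_edges"
  shows "H1e_inner N l (\<lambda>j x. u j x + v j x) w = H1e_inner N l u w + H1e_inner N l v w"
proof -
  note u = H1_edges_primitive[OF assms(1)] and v = H1_edges_primitive[OF assms(2)]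
    and w = H1_edges_primitive[OF assms(3)]
  let ?I = "\<lambda>u v j. integral {0..l j} (\<lambda>x. u j x * v j x + wderiv (l j) (u j) x * wderiv (l j) (v j) x)"
  have "H1e_inner N l (\<lambda>j x. u j x + v j x) w
      = (\<Sum>j=1..N. integral {0..l j} (\<lambda>x. (u j x + v j x) * w j x
          + (wderiv (l j) (u j) x + wderiv (l j) (v j) x) * wderiv (l j) (w j) x))"
    by (intro H1e_inner_eq primitive_add L2_add u v w)
  also have "\<dots> = (\<Sum>j=1..N. ?I u w j + ?I v w j)"
  proof (intro sum.cong refl)
    fix j assume j: "j \<in> {1..N}"
    note i = H1_inner_integrable[OF u[OF j] w[OF j]] H1_inner_integrable[OF v[OF j] w[OF j]]
    show "integral {0..l j} (\<lambda>x. (u j x + v j x) * w j x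
          + (wderiv (l j) (u j) x + wderiv (l j) (v j) x) * wderiv (l j) (w j) x) = ?I u w j + ?I v w j"
      unfolding Henstock_Kurzweil_Integration.integral_add[OF i, symmetric]
      by (intro integral_cong) (simp add: algebra_simps)
  qed
  also have "\<dots> = H1e_inner N l u w + H1e_inner N l v w"
    unfolding sum.distrib H1e_inner_wderiv[OF assms(1,3)] H1e_inner_wderiv[OF assms(2,3)] ..
  finally show ?thesis .
qed

lemma H1e_inner_cmult:
  assumes "u \<in> H1_edges" "v \<in> H1_edges"
  shows "H1e_inner N l (\<lambda>j x. c * u j x) v = c * H1e_inner N l u v"
proof -
  note u = H1_edges_primitive[OF assms(1)] and v = H1_edges_primitive[OF assms(2)]
  have "H1e_inner N l (\<lambda>j x. c * u j x) v
      = (\<Sum>j=1..N. integral {0..l j} (\<lambda>x. (c * u j x) * v j x + (c * wderiv (l j) (u j) x) * wderiv (l j) (v j) x))"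
    by (intro H1e_inner_eq primitive_cmult L2_cmult u v)
  also have "\<dots> = (\<Sum>j=1..N. c * integral {0..l j} (\<lambda>x. u j x * v j x + wderiv (l j) (u j) x * wderiv (l j) (v j) x))"
    unfolding integral_mult_right[symmetric] by (simp add: algebra_simps)
  also have "\<dots> = c * H1e_inner N l u v"
    unfolding H1e_inner_wderiv[OF assms] sum_distrib_left ..
  finally show ?thesis .
qed

text \<open>The Sobolev inequality on the edge that contains the point; the energies of the other edges are
  nonnegative.\<close>

lemma abs_le_H1e_norm:
  assumes u: "u \<in> H1e N l" and j: "j \<in> {1..N}" and x: "x \<in> {0..l j}"
  shows "(u j x)\<^sup>2 \<le> H1e_inner N l u u" "\<bar>u j x\<bar> \<le> H1e_norm N l u"
proof -
  have ue: "u \<in> H1_edges" and u0: "\<And>j. j \<in> {1..N} \<Longrightarrow> u j (l j) = 0" using u by (auto simp: H1e_iff)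
  note p = H1_edges_primitive[OF ue]
  let ?I = "\<lambda>j. integral {0..l j} (\<lambda>x. u j x * u j x + wderiv (l j) (u j) x * wderiv (l j) (u j) x)"
  have "(u j x)\<^sup>2 \<le> ?I j" by (rule square_le_H1_energy[OF p[OF j] u0[OF j] x])
  also have "?I j \<le> (\<Sum>j=1..N. ?I j)"
    using j by (intro member_le_sum) (auto intro!: integral_nonneg H1_inner_integrable p)
  also have "\<dots> = H1e_inner N l u u" by (intro H1e_inner_eq[symmetric] p)
  finally show le: "(u j x)\<^sup>2 \<le> H1e_inner N l u u" .
  then show "\<bar>u j x\<bar> \<le> H1e_norm N l u"
    unfolding H1e_norm_def using real_sqrt_le_mono[OF le] by simp
qed

lemma prim_in_H1_edges: "(\<lambda>j x. apply_bcontfun (prim G) (j, x)) \<in> H1_edges"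
  unfolding H1_edges_def using prim_in_H1 by auto

lemma H1e_inner_prim_bound:
  "\<exists>C\<ge>0. \<forall>G H. \<bar>H1e_inner N l (\<lambda>j x. apply_bcontfun (prim G) (j, x)) (\<lambda>j x. apply_bcontfun (prim H) (j, x))\<bar>
     \<le> norm G * norm H * C"
proof -
  obtain B where B: "B \<ge> 0" "\<And>G. norm (prim G) \<le> norm G * B"
    using bounded_linear.nonneg_bounded[OF bounded_linear_prim] by blast
  have "\<bar>H1e_inner N l (\<lambda>j x. apply_bcontfun (prim G) (j, x)) (\<lambda>j x. apply_bcontfun (prim H) (j, x))\<bar>
     \<le> norm G * norm H * (\<Sum>j=1..N. (B * B + 1) * l j)" for G H
  proof -
    let ?f = "\<lambda>j x. apply_bcontfun (prim G) (j, x) * apply_bcontfun (prim H) (j, x)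
        + apply_bcontfun G (j, x) * apply_bcontfun H (j, x)"
    have "H1e_inner N l (\<lambda>j x. apply_bcontfun (prim G) (j, x)) (\<lambda>j x. apply_bcontfun (prim H) (j, x))
        = (\<Sum>j=1..N. integral {0..l j} (?f j))"
      by (intro H1e_inner_eq primitive_prim continuous_on_imp_L2 continuous_on_state_edge)
    also have "\<bar>\<dots>\<bar> \<le> (\<Sum>j=1..N. \<bar>integral {0..l j} (?f j)\<bar>)" by (rule sum_abs)
    also have "\<dots> \<le> (\<Sum>j=1..N. (norm G * norm H * (B * B + 1)) * l j)"
    proof (rule sum_mono)
      fix j assume j: "j \<in> {1..N}"
      have le: "\<bar>?f j x\<bar> \<le> norm G * norm H * (B * B + 1)" for x
      proof -
        have "\<bar>apply_bcontfun (prim G) (j, x) * apply_bcontfun (prim H) (j, x)\<bar> \<le> (norm G * B) * (norm H * B)"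
          unfolding abs_mult using B
          by (intro mult_mono order_trans[OF abs_le_norm_state B(2)]) auto
        moreover have "\<bar>apply_bcontfun G (j, x) * apply_bcontfun H (j, x)\<bar> \<le> norm G * norm H"
          unfolding abs_mult by (intro mult_mono abs_le_norm_state) auto
        ultimately show ?thesis
          using abs_triangle_ineq[of "apply_bcontfun (prim G) (j, x) * apply_bcontfun (prim H) (j, x)"
              "apply_bcontfun G (j, x) * apply_bcontfun H (j, x)"]
          by (simp add: algebra_simps)
      qed
      have "norm (integral {0..l j} (?f j)) \<le> (norm G * norm H * (B * B + 1)) * (l j - 0)"
        using l[OF j] le by (intro integral_bound continuous_intros continuous_on_state_edge) auto
      then show "\<bar>integral {0..l j} (?f j)\<bar> \<le> (norm G * norm H * (B * B + 1)) * l j" by simp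
    qed
    also have "\<dots> = norm G * norm H * (\<Sum>j=1..N. (B * B + 1) * l j)"
      by (simp add: sum_distrib_left mult.assoc)
    finally show ?thesis .
  qed
  moreover have "0 \<le> (\<Sum>j=1..N. (B * B + 1) * l j)"
    using l by (intro sum_nonneg mult_nonneg_nonneg) (auto intro: less_imp_le)
  ultimately show ?thesis by blast
qed

lemma H1e_norm_prim_bound:
  "\<exists>C\<ge>0. \<forall>G. H1e_norm N l (\<lambda>j x. apply_bcontfun (prim G) (j, x)) \<le> C * norm G"
proof -
  obtain C where C: "C \<ge> 0" "\<And>G H. \<bar>H1e_inner N l (\<lambda>j x. apply_bcontfun (prim G) (j, x)) (\<lambda>j x. apply_bcontfun (prim H) (j, x))\<bar>
     \<le> norm G * norm H * C"
    using H1e_inner_prim_bound by blast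
  have "H1e_norm N l (\<lambda>j x. apply_bcontfun (prim G) (j, x)) \<le> sqrt C * norm G" for G
  proof -
    have "H1e_norm N l (\<lambda>j x. apply_bcontfun (prim G) (j, x)) \<le> sqrt (norm G * norm G * C)"
      unfolding H1e_norm_def using C(2)[of G G] by (intro real_sqrt_le_mono) linarith
    then show ?thesis by (simp add: real_sqrt_mult mult.commute)
  qed
  with C(1) show ?thesis by (intro exI[of _ "sqrt C"]) auto
qed

text \<open>With the next lemma, \<open>\<parallel>u\<^sub>0 + prim G\<parallel>\<^sup>2\<close> is a continuous polynomial of degree 2 in \<open>G\<close>, which
  makes the energy differentiable in time.\<close>

lemma bounded_bilinear_inner_prim:
  "bounded_bilinear (\<lambda>G H. H1e_inner N l (\<lambda>j x. apply_bcontfun (prim G) (j, x)) (\<lambda>j x. apply_bcontfun (prim H) (j, x)))"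
proof
  let ?P = "\<lambda>G j x. apply_bcontfun (prim G) (j, x)"
  note lin = linear_simps[OF bounded_linear_prim]
  show add: "H1e_inner N l (?P (G + G')) (?P H) = H1e_inner N l (?P G) (?P H) + H1e_inner N l (?P G') (?P H)" for G G' H
    using H1e_inner_add[OF prim_in_H1_edges prim_in_H1_edges prim_in_H1_edges, of G G' H] by (simp add: lin)
  show scale: "H1e_inner N l (?P (c *\<^sub>R G)) (?P H) = c *\<^sub>R H1e_inner N l (?P G) (?P H)" for c G H
    using H1e_inner_cmult[OF prim_in_H1_edges prim_in_H1_edges, of c G H] by (simp add: lin)
  show "H1e_inner N l (?P H) (?P (G + G')) = H1e_inner N l (?P H) (?P G) + H1e_inner N l (?P H) (?P G')" for G G' H
    using add[of G G' H] by (simp only: H1e_inner_commute[of "?P H"])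
  show "H1e_inner N l (?P H) (?P (c *\<^sub>R G)) = c *\<^sub>R H1e_inner N l (?P H) (?P G)" for c G H
    using scale[of c G H] by (simp only: H1e_inner_commute[of "?P H"])
  show "\<exists>K. \<forall>G H. norm (H1e_inner N l (?P G) (?P H)) \<le> norm G * norm H * K"
    using H1e_inner_prim_bound by auto
qed

lemma bounded_linear_inner_prim:
  assumes u: "u \<in> H1_edges"
  shows "bounded_linear (\<lambda>G. H1e_inner N l u (\<lambda>j x. apply_bcontfun (prim G) (j, x)))"
proof -
  let ?P = "\<lambda>G j x. apply_bcontfun (prim G) (j, x)"
  note lin = linear_simps[OF bounded_linear_prim]
  note p = H1_edges_primitive[OF u]
  obtain B where B: "B \<ge> 0" "\<And>G. norm (prim G) \<le> norm G * B"
    using bounded_linear.nonneg_bounded[OF bounded_linear_prim] by blast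
  let ?u' = "\<lambda>j. wderiv (l j) (u j)"
  let ?M = "\<lambda>j. integral {0..l j} (\<lambda>x. B * \<bar>u j x\<bar> + \<bar>?u' j x\<bar>)"
  show ?thesis
  proof (rule bounded_linear_intro[where K = "\<Sum>j=1..N. ?M j"])
    show "H1e_inner N l u (?P (G + G')) = H1e_inner N l u (?P G) + H1e_inner N l u (?P G')" for G G'
      using H1e_inner_add[OF prim_in_H1_edges prim_in_H1_edges u, of G G']
      by (simp add: lin H1e_inner_commute[of u])
    show "H1e_inner N l u (?P (c *\<^sub>R G)) = c *\<^sub>R H1e_inner N l u (?P G)" for c G
      using H1e_inner_cmult[OF prim_in_H1_edges u, of c G] by (simp add: lin H1e_inner_commute[of u])
    show "norm (H1e_inner N l u (?P G)) \<le> norm G * (\<Sum>j=1..N. ?M j)" for G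
    proof -
      let ?f = "\<lambda>j x. u j x * apply_bcontfun (prim G) (j, x) + ?u' j x * apply_bcontfun G (j, x)"
      have "H1e_inner N l u (?P G) = (\<Sum>j=1..N. integral {0..l j} (?f j))"
        by (intro H1e_inner_eq p primitive_prim continuous_on_imp_L2 continuous_on_state_edge)
      then have "norm (H1e_inner N l u (?P G)) \<le> (\<Sum>j=1..N. norm (integral {0..l j} (?f j)))"
        by (simp only: norm_sum)
      also have "\<dots> \<le> (\<Sum>j=1..N. norm G * ?M j)"
      proof (rule sum_mono)
        fix j assume j: "j \<in> {1..N}"
        have "norm (integral {0..l j} (?f j)) \<le> integral {0..l j} (\<lambda>x. norm G * (B * \<bar>u j x\<bar> + \<bar>?u' j x\<bar>))"
        proof (rule integral_norm_bound_integral)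
          show "?f j integrable_on {0..l j}"
            using j by (intro H1_inner_integrable p primitive_prim continuous_on_imp_L2 continuous_on_state_edge)
          have "(\<lambda>x. \<bar>u j x\<bar>) absolutely_integrable_on {0..l j}"
            using primitive_continuous_on[OF p(1)[OF j]]
            by (intro absolutely_integrable_continuous_real continuous_intros)
          moreover have "(\<lambda>x. \<bar>?u' j x\<bar>) absolutely_integrable_on {0..l j}"
            using absolutely_integrable_norm[OF primitiveD(1)[OF p(1)[OF j]]] by (simp add: o_def)
          ultimately show "(\<lambda>x. norm G * (B * \<bar>u j x\<bar> + \<bar>?u' j x\<bar>)) integrable_on {0..l j}"
            by (intro absolutely_integrable_imp_integrable set_integrable_mult_right set_integral_add) auto
          fix x
          have "\<bar>u j x * apply_bcontfun (prim G) (j, x)\<bar> \<le> \<bar>u j x\<bar> * (norm G * B)"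
            unfolding abs_mult by (intro mult_left_mono order_trans[OF abs_le_norm_state B(2)]) auto
          moreover have "\<bar>?u' j x * apply_bcontfun G (j, x)\<bar> \<le> \<bar>?u' j x\<bar> * norm G"
            unfolding abs_mult by (intro mult_left_mono abs_le_norm_state) auto
          ultimately show "norm (?f j x) \<le> norm G * (B * \<bar>u j x\<bar> + \<bar>?u' j x\<bar>)"
            using abs_triangle_ineq[of "u j x * apply_bcontfun (prim G) (j, x)" "?u' j x * apply_bcontfun G (j, x)"]
            by (simp add: algebra_simps)
        qed
        then show "norm (integral {0..l j} (?f j)) \<le> norm G * ?M j" by simp
      qed
      finally show ?thesis by (simp add: sum_distrib_left)
    qed
  qed
qed

section \<open>Energy identities for the elliptic problem\<close>

text \<open>Turns the elliptic equation, an identity almost everywhere between chosen representatives, into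
  a statement about primitives, to which the product rule applies.\<close>

lemma elliptic_solution_primitives:
  assumes u: "u \<in> H1e N l" and v: "elliptic_solution N l \<alpha> u v" and j: "j \<in> {1..N}"
  shows "primitive (l j) (v j) (cderiv (l j) (v j))" "continuous_on {0..l j} (cderiv (l j) (v j))"
    "primitive (l j) (cderiv (l j) (v j))
       (\<lambda>x. v j x + (wderiv (l j) (u j) x + u j x * wderiv (l j) (u j) x))"
proof -
  have vj: "v j \<in> H2 (l j)" using v j by (simp add: elliptic_solution_def)
  note lj = l[OF j] and c = H2_primitive[OF l[OF j] vj]
  have ue: "u \<in> H1_edges" using u by (simp add: H1e_iff)
  note p = H1_edges_primitive[OF ue j]
  show vp: "primitive (l j) (v j) (cderiv (l j) (v j))" by (rule c)
  show "continuous_on {0..l j} (cderiv (l j) (v j))" using c(1) by (simp add: H1_def)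
  have "AE x in lebesgue_on {0<..<l j}. v j x - wderiv (l j) (cderiv (l j) (v j)) x
          = - wderiv (l j) (u j) x - u j x * wderiv (l j) (u j) x"
    using v j unfolding elliptic_solution_def by blast
  then have eq: "AE x in lebesgue_on {0<..<l j}. wderiv (l j) (cderiv (l j) (v j)) x
       = v j x + (wderiv (l j) (u j) x + u j x * wderiv (l j) (u j) x)"
    by eventually_elim (simp add: algebra_simps)
  show "primitive (l j) (cderiv (l j) (v j))
       (\<lambda>x. v j x + (wderiv (l j) (u j) x + u j x * wderiv (l j) (u j) x))"
    by (rule primitive_cong_AE[OF H1_primitive(2)[OF lj c(1)] _ eq])
      (intro set_integral_add absolutely_integrable_continuous_mult
        absolutely_integrable_continuous_real primitive_continuous_on[OF vp] primitive_continuous_on[OF p(1)]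
        primitiveD(1)[OF p(1)])
qed

text \<open>The difference \<open>z\<close> of two solutions satisfies \<open>z'' = z\<close>. Integrating \<open>(z * z')'\<close> over all edges gives
  \<open>\<parallel>z\<parallel>\<^sup>2 = - z(0) * (\<Sum>j. z\<^sub>j'(0)) = 0\<close>, as the values at the outer ends vanish.\<close>

lemma elliptic_solution_unique:
  assumes u: "u \<in> H1e N l" and v: "elliptic_solution N l \<alpha> u v" and w: "elliptic_solution N l \<alpha> u w"
  shows "net_eq N l v w"
proof -
  define z z' where "z = (\<lambda>j x. v j x - w j x)"
    and "z' = (\<lambda>j x. cderiv (l j) (v j) x - cderiv (l j) (w j) x)"
  have p: "primitive (l j) (z j) (z' j)" "continuous_on {0..l j} (z' j)" "primitive (l j) (z' j) (z j)"
    if j: "j \<in> {1..N}" for j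
  proof -
    note a = elliptic_solution_primitives[OF u v j] and b = elliptic_solution_primitives[OF u w j]
    show "primitive (l j) (z j) (z' j)" unfolding z_def z'_def by (rule primitive_diff[OF a(1) b(1)])
    show "continuous_on {0..l j} (z' j)" unfolding z'_def by (intro continuous_intros a b)
    show "primitive (l j) (z' j) (z j)"
      unfolding z_def z'_def using primitive_diff[OF a(3) b(3)] by simp
  qed
  have L2: "z' j \<in> L2 (l j)" if "j \<in> {1..N}" for j by (rule continuous_on_imp_L2[OF p(2)[OF that]])
  have end0: "z j (l j) = 0" if "j \<in> {1..N}" for j
    using v w that unfolding elliptic_solution_def z_def by simp
  have node: "z j 0 = z 1 0" if "j \<in> {1..N}" for j
  proof -
    have "1 \<in> {1..N}" using N by simp
    then have "v j 0 = v 1 0" "w j 0 = w 1 0" using v w that unfolding elliptic_solution_def by blast+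
    then show ?thesis by (simp add: z_def)
  qed
  have zH: "z \<in> H1e N l"
    by (rule H1eI[OF H1_edgesI[OF p(1) L2] end0 node])
  have "H1e_inner N l z z = (\<Sum>j=1..N. integral {0..l j} (\<lambda>x. z j x * z j x + z' j x * z' j x))"
    by (intro H1e_inner_eq p L2)
  also have "\<dots> = (\<Sum>j=1..N. - (z 1 0 * z' j 0))"
  proof (intro sum.cong refl)
    fix j assume j: "j \<in> {1..N}"
    have "integral {0..l j} (\<lambda>x. z' j x * z' j x + z j x * z j x) = z j (l j) * z' j (l j) - z j 0 * z' j 0"
      using primitiveD(2)[OF primitive_mult[OF p(1)[OF j] p(3)[OF j]], of "l j"] l[OF j] by auto
    then show "integral {0..l j} (\<lambda>x. z j x * z j x + z' j x * z' j x) = - (z 1 0 * z' j 0)"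
      using end0[OF j] node[OF j] by (simp add: add.commute)
  qed
  also have "\<dots> = - z 1 0 * (\<Sum>j=1..N. z' j 0)" by (simp add: sum_distrib_left)
  also have "(\<Sum>j=1..N. z' j 0) = 0"
    using v w unfolding elliptic_solution_def z'_def by (simp add: sum_subtractf)
  finally have "H1e_inner N l z z = 0" by simp
  then have "z j x = 0" if "j \<in> {1..N}" "x \<in> {0..l j}" for j x
    using abs_le_H1e_norm(1)[OF zH that] by simp
  then show ?thesis unfolding net_eq_def z_def by auto
qed

text \<open>Because \<open>v'' = v + u' + u * u'\<close>, the density \<open>u * v + u' * v'\<close> of the inner product is the
  derivative of \<open>u * v' - u\<^sup>2/2 - u\<^sup>3/3\<close>, so that only values at the node remain. The condition
  on the sum of the \<open>v\<^sub>j'(0)\<close> cancels the cubic terms.\<close>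

lemma elliptic_energy_identity:
  assumes u: "u \<in> H1e N l" and v: "elliptic_solution N l \<alpha> u v"
  shows "H1e_inner N l u v = (real N / 2 - \<alpha>) * (u 1 0)\<^sup>2"
proof -
  have ue: "u \<in> H1_edges" using u by (simp add: H1e_iff)
  note p = H1_edges_primitive[OF ue] and q = elliptic_solution_primitives[OF u v]
  let ?u' = "\<lambda>j. wderiv (l j) (u j)" and ?q = "\<lambda>j. cderiv (l j) (v j)"
  have "1 \<in> {1..N}" using N by simp
  then have node: "u j 0 = u 1 0" if "j \<in> {1..N}" for j using H1eD(4)[OF u that] by blast
  have "H1e_inner N l u v = (\<Sum>j=1..N. integral {0..l j} (\<lambda>x. u j x * v j x + ?u' j x * ?q j x))"
    by (intro H1e_inner_eq p q continuous_on_imp_L2)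
  also have "\<dots> = (\<Sum>j=1..N. (u 1 0)\<^sup>2 / 2 + (u 1 0)^3 / 3 - u 1 0 * ?q j 0)"
  proof (intro sum.cong refl)
    fix j assume j: "j \<in> {1..N}"
    note uq = primitive_mult[OF p(1)[OF j] q(3)[OF j]]
    note uu = primitive_mult[OF p(1)[OF j] p(1)[OF j]]
    note P = primitive_diff[OF uq primitive_add[OF primitive_cmult[OF uu, of "1/2"]
          primitive_cmult[OF primitive_mult[OF uu p(1)[OF j]], of "1/3"]]]
    have "integral {0..l j} (\<lambda>x. u j x * v j x + ?u' j x * ?q j x)
        = integral {0..l j} (\<lambda>x. ?u' j x * ?q j x + u j x * (v j x + (?u' j x + u j x * ?u' j x))
          - (1/2 * (?u' j x * u j x + u j x * ?u' j x)
             + 1/3 * ((?u' j x * u j x + u j x * ?u' j x) * u j x + u j x * u j x * ?u' j x)))"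
      by (intro integral_cong) (simp add: field_simps)
    also have "\<dots> = (u j (l j) * ?q j (l j) - (1/2 * (u j (l j) * u j (l j)) + 1/3 * (u j (l j) * u j (l j) * u j (l j))))
       - (u j 0 * ?q j 0 - (1/2 * (u j 0 * u j 0) + 1/3 * (u j 0 * u j 0 * u j 0)))"
      by (rule primitiveD(2)[OF P]) (use l[OF j] in auto)
    also have "\<dots> = (u 1 0)\<^sup>2 / 2 + (u 1 0)^3 / 3 - u 1 0 * ?q j 0"
      using H1eD(3)[OF u j] node[OF j] by (simp add: power2_eq_square power3_eq_cube)
    finally show "integral {0..l j} (\<lambda>x. u j x * v j x + ?u' j x * ?q j x)
        = (u 1 0)\<^sup>2 / 2 + (u 1 0)^3 / 3 - u 1 0 * ?q j 0" .
  qed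
  also have "\<dots> = real N * ((u 1 0)\<^sup>2 / 2 + (u 1 0)^3 / 3) - u 1 0 * (\<Sum>j=1..N. ?q j 0)"
    by (simp add: sum_subtractf sum_distrib_left)
  also have "(\<Sum>j=1..N. ?q j 0) = \<alpha> * u 1 0 + real N / 3 * (u 1 0)\<^sup>2"
    using v unfolding elliptic_solution_def by blast
  finally show ?thesis by (simp add: power2_eq_square power3_eq_cube field_simps)
qed


section \<open>Existence and uniqueness of global solutions\<close>

lemma lift_cong:
  assumes "\<And>j x. j \<in> {1..N} \<Longrightarrow> x \<in> {0..l j} \<Longrightarrow> u j x = v j x"
  shows "lift u = lift v"
proof -
  have "u j (max 0 (min (l j) x)) = v j (max 0 (min (l j) x))" if "j \<in> {1..N}" for j x
    using l[OF that] by (intro assms that) auto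
  then show ?thesis unfolding lift_def by (intro arg_cong[where f = Bcontfun]) (auto simp: fun_eq_iff)
qed

lemma rhs_cong:
  assumes eq: "\<And>j x. j \<in> {1..N} \<Longrightarrow> x \<in> {0..l j} \<Longrightarrow> apply_bcontfun f (j, x) = apply_bcontfun g (j, x)"
  shows "rhs \<alpha> R f = rhs \<alpha> R g"
proof -
  have "edge_data R f = edge_data R g" unfolding edge_data_def by (intro lift_cong) (simp add: eq)
  moreover have "apply_bcontfun f (1, 0) = apply_bcontfun g (1, 0)"
    using N l[of 1] by (intro eq) auto
  ultimately show ?thesis by (simp add: rhs_def node_data_def)
qed

lemma bounded_linear_prim_eval: "bounded_linear (\<lambda>G. apply_bcontfun (prim G) (j, x))"
proof -
  obtain B where B: "\<And>G. norm (prim G) \<le> norm G * B"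
    using bounded_linear.bounded[OF bounded_linear_prim] by blast
  show ?thesis
    using order_trans[OF abs_le_norm_state B]
    by (intro bounded_linear_intro[where K = B]) (auto simp: linear_simps[OF bounded_linear_prim])
qed

lemma H1e_norm_nonneg:
  assumes "u \<in> H1e N l"
  shows "0 \<le> H1e_norm N l u"
proof -
  have "\<bar>u 1 0\<bar> \<le> H1e_norm N l u" using N l[of 1] by (intro abs_le_H1e_norm(2)[OF assms]) auto
  then show ?thesis by linarith
qed

lemma H1e_norm_square:
  assumes u: "u \<in> H1e N l"
  shows "(H1e_norm N l u)\<^sup>2 = H1e_inner N l u u"
proof -
  have "0 \<le> (u 1 0)\<^sup>2" by simp
  also have "\<dots> \<le> H1e_inner N l u u" using N l[of 1] by (intro abs_le_H1e_norm(1)[OF u]) auto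
  finally show ?thesis by (simp add: H1e_norm_def)
qed

lemma H1e_norm_prim_nonneg: "0 \<le> H1e_norm N l (\<lambda>j x. apply_bcontfun (prim G) (j, x))"
proof -
  have "H1e_inner N l (\<lambda>j x. apply_bcontfun (prim G) (j, x)) (\<lambda>j x. apply_bcontfun (prim G) (j, x))
      = (\<Sum>j=1..N. integral {0..l j} (\<lambda>x. apply_bcontfun (prim G) (j, x) * apply_bcontfun (prim G) (j, x)
        + apply_bcontfun G (j, x) * apply_bcontfun G (j, x)))"
    by (intro H1e_inner_eq primitive_prim continuous_on_imp_L2 continuous_on_state_edge)
  also have "\<dots> \<ge> 0"
    by (intro sum_nonneg integral_nonneg integrable_continuous_real continuous_intros continuous_on_state_edge) auto
  finally show ?thesis by (simp add: H1e_norm_def)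
qed

text \<open>The norm of \<open>prim G\<close> in \<open>H1e\<close> is at most a multiple of the supremum norm of \<open>G\<close>, so a gauge for
  the integral of the derivatives serves for the integral in \<open>H1e\<close> as well.\<close>

lemma has_integral_H1e_prim:
  assumes f: "(f has_integral I) {0..t}"
    and mem: "\<And>s. s \<in> {0..t} \<Longrightarrow> (\<lambda>j x. apply_bcontfun (prim (f s)) (j, x)) \<in> H1e N l"
      "(\<lambda>j x. apply_bcontfun (prim I) (j, x)) \<in> H1e N l"
  shows "has_integral_H1e N l (\<lambda>s j x. apply_bcontfun (prim (f s)) (j, x)) (\<lambda>j x. apply_bcontfun (prim I) (j, x)) t"
  unfolding has_integral_H1e_def
proof (intro conjI ballI allI impI mem)
  fix e :: real assume e: "e > 0"
  obtain C where C: "C \<ge> 0" "\<And>G. H1e_norm N l (\<lambda>j x. apply_bcontfun (prim G) (j, x)) \<le> C * norm G"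
    using H1e_norm_prim_bound by blast
  have "e / (C + 1) > 0" using e C by simp
  from f[unfolded has_integral_real, rule_format, OF this]
  obtain \<gamma> where \<gamma>: "gauge \<gamma>" "\<forall>D. D tagged_division_of {0..t} \<and> \<gamma> fine D \<longrightarrow>
      norm ((\<Sum>(s, K)\<in>D. measure lborel K *\<^sub>R f s) - I) < e / (C + 1)"
    by (elim exE conjE)
  show "\<exists>\<gamma>. gauge \<gamma> \<and> (\<forall>D. D tagged_division_of {0..t} \<and> \<gamma> fine D \<longrightarrow>
           H1e_norm N l (\<lambda>j x. (\<Sum>(\<tau>, K)\<in>D. measure lborel K * apply_bcontfun (prim (f \<tau>)) (j, x))
              - apply_bcontfun (prim I) (j, x)) < e)"
  proof (intro exI[of _ \<gamma>] conjI allI impI \<gamma>(1))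
    fix D assume D: "D tagged_division_of {0..t} \<and> \<gamma> fine D"
    define S where "S = (\<Sum>(s, K)\<in>D. measure lborel K *\<^sub>R f s)"
    have "(\<Sum>(\<tau>, K)\<in>D. measure lborel K * apply_bcontfun (prim (f \<tau>)) (j, x)) - apply_bcontfun (prim I) (j, x)
        = apply_bcontfun (prim (S - I)) (j, x)" for j x
      unfolding linear_simps(2)[OF bounded_linear_prim_eval] S_def
        bounded_linear.linear[OF bounded_linear_prim_eval, THEN linear_sum]
      by (simp add: case_prod_unfold linear_simps(5)[OF bounded_linear_prim_eval])
    then have "H1e_norm N l (\<lambda>j x. (\<Sum>(\<tau>, K)\<in>D. measure lborel K * apply_bcontfun (prim (f \<tau>)) (j, x))
              - apply_bcontfun (prim I) (j, x)) \<le> C * norm (S - I)" using C(2)[of "S - I"] by simp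
    also have "\<dots> \<le> C * (e / (C + 1))"
      using \<gamma>(2)[rule_format, OF D] C(1) unfolding S_def by (intro mult_left_mono) auto
    also have "\<dots> < e" using C e by (simp add: field_simps)
    finally show "H1e_norm N l (\<lambda>j x. (\<Sum>(\<tau>, K)\<in>D. measure lborel K * apply_bcontfun (prim (f \<tau>)) (j, x))
              - apply_bcontfun (prim I) (j, x)) < e" .
  qed
qed

text \<open>Evaluation at a point is bounded by the norm of \<open>H1e\<close>, by the Sobolev inequality.\<close>

lemma has_integral_H1e_imp_pointwise:
  assumes I: "has_integral_H1e N l v w t" and j: "j \<in> {1..N}" and x: "x \<in> {0..l j}"
  shows "((\<lambda>s. v s j x) has_integral w j x) {0..t}"
  unfolding has_integral_real
proof (intro allI impI)
  fix e :: real assume "e > 0"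
  from I[unfolded has_integral_H1e_def, THEN conjunct2, THEN conjunct2, rule_format, OF this]
  obtain \<gamma> where \<gamma>: "gauge \<gamma>" "\<forall>D. D tagged_division_of {0..t} \<and> \<gamma> fine D \<longrightarrow>
      H1e_norm N l (\<lambda>j x. (\<Sum>(\<tau>, K)\<in>D. measure lborel K * v \<tau> j x) - w j x) < e"
    by (elim exE conjE)
  show "\<exists>\<gamma>. gauge \<gamma> \<and> (\<forall>D. D tagged_division_of {0..t} \<and> \<gamma> fine D \<longrightarrow>
      norm ((\<Sum>(s, K)\<in>D. measure lborel K *\<^sub>R v s j x) - w j x) < e)"
  proof (intro exI[of _ \<gamma>] conjI allI impI \<gamma>(1))
    fix D assume D: "D tagged_division_of {0..t} \<and> \<gamma> fine D"
    have "(\<lambda>j x. (\<Sum>p\<in>D. measure lborel (snd p) * v (fst p) j x) - w j x) \<in> H1e N l"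
    proof (intro H1e_diff H1e_sum H1e_cmult)
      fix p assume "p \<in> D"
      then have "fst p \<in> snd p" "snd p \<subseteq> {0..t}"
        using D tagged_division_ofD(2,3)[of D "{0..t}" "fst p" "snd p"] by auto
      then show "v (fst p) \<in> H1e N l" using I unfolding has_integral_H1e_def by auto
    qed (use I in \<open>auto simp: has_integral_H1e_def\<close>)
    from abs_le_H1e_norm(2)[OF this j x] \<gamma>(2)[rule_format, OF D]
    show "norm ((\<Sum>(s, K)\<in>D. measure lborel K *\<^sub>R v s j x) - w j x) < e"
      by (simp add: case_prod_unfold)
  qed
qed

text \<open>The truncation height exceeds the norm of the initial datum, so the energy starts strictly below
  the barrier \<open>R\<^sup>2\<close> and never reaches it.\<close>

theorem BBM_solution_exists:
  assumes \<alpha>: "\<alpha> \<ge> real N / 2" and u0: "u0 \<in> H1e N l"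
  shows "\<exists>u. BBM_solution N l \<alpha> u0 u"
proof -
  let ?P = "\<lambda>G j x. apply_bcontfun (prim G) (j, x)"
  define R where "R = H1e_norm N l u0 + 1"
  note norm0 = H1e_norm_nonneg[OF u0]
  then have R: "0 \<le> R" by (simp add: R_def)
  define F where "F G = rhs \<alpha> R (lift u0 + prim G)" for G
  obtain K where K: "K > 0" "\<And>u v. norm (rhs \<alpha> R u - rhs \<alpha> R v) \<le> K * norm (u - v)"
    using rhs_Lipschitz[OF R] by blast
  obtain B where B: "B > 0" "\<And>G. norm (prim G) \<le> norm G * B"
    using bounded_linear.pos_bounded[OF bounded_linear_prim] by blast
  have F: "norm (F G - F H) \<le> (K * B) * norm (G - H)" for G H
  proof -
    have "norm (F G - F H) \<le> K * norm (prim (G - H))"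
      using K(2)[of "lift u0 + prim G" "lift u0 + prim H"]
      by (simp add: F_def linear_simps[OF bounded_linear_prim])
    also have "\<dots> \<le> K * (norm (G - H) * B)" using K(1) B(2) by (intro mult_left_mono) auto
    finally show ?thesis by (simp add: mult_ac)
  qed
  have KB: "K * B > 0" using K B by simp
  obtain G :: "real \<Rightarrow> net_state" where Gc: "continuous_on UNIV G"
    and G: "\<And>t. 0 \<le> t \<Longrightarrow> G t = integral {0..t} (\<lambda>s. F (G s))"
    using global_solution_of_Lipschitz_ODE[of "K * B" F, OF KB F] by blast
  have Fc: "continuous_on S F" for S
    using F KB by (intro lipschitz_on_continuous_on[of "K * B"] lipschitz_onI) (auto simp: dist_norm)
  have FGc: "continuous_on S (\<lambda>s. F (G s))" for S
    by (rule continuous_on_compose2[OF Fc[of UNIV] continuous_on_subset[OF Gc]]) auto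
  have Gint: "((\<lambda>s. F (G s)) has_integral G t) {0..t}" if "0 \<le> t" for t
    unfolding G[OF that] by (intro integrable_integral integrable_continuous_real FGc)
  have Gder: "(G has_vector_derivative F (G t)) (at t)" if "0 < t" for t
  proof -
    have "((\<lambda>u. integral {0..u} (\<lambda>s. F (G s))) has_vector_derivative F (G t)) (at t within {0..t + 1})"
      by (rule integral_has_vector_derivative[OF FGc]) (use that in auto)
    then have "(G has_vector_derivative F (G t)) (at t within {0..t + 1})"
    proof (rule has_vector_derivative_transform[rotated 2])
      show "G s = integral {0..s} (\<lambda>s. F (G s))" if "s \<in> {0..t + 1}" for s
        by (rule G) (use that in simp)
    qed (use that in simp)
    moreover have "t < t + 1" by simp
    ultimately show ?thesis using that by (simp only: at_within_Icc_at[of 0 t "t + 1"])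
  qed
  define u where "u t j x = u0 j x + ?P (G t) j x" for t j x
  have Fstate: "rhs \<alpha> R (lift (u t)) = F (G t)" for t
  proof -
    have "net_continuous (u t)"
      unfolding u_def[abs_def] net_continuous_def using H1eD(1)[OF u0]
      by (auto simp: net_continuous_def intro!: continuous_intros continuous_on_state_edge)
    then show ?thesis
      unfolding F_def using H1eD(1)[OF u0] by (intro rhs_cong) (simp add: u_def)
  qed
  \<comment> \<open>Continuity at the node is a linear condition; all \<open>F (G s)\<close> satisfy it, hence so does \<open>G t\<close>.\<close>
  have node: "?P (G t) j 0 = ?P (G t) 1 0" if t: "0 \<le> t" and j: "j \<in> {1..N}" for t j
  proof -
    have bl: "bounded_linear (\<lambda>g. ?P g j 0 - ?P g 1 0)"
      by (intro bounded_linear_sub bounded_linear_prim_eval)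
    have "((\<lambda>s. ?P (F (G s)) j 0 - ?P (F (G s)) 1 0) has_integral (?P (G t) j 0 - ?P (G t) 1 0)) {0..t}"
      using has_integral_linear[OF Gint[OF t] bl] by (simp add: o_def)
    moreover have "?P (F (G s)) j 0 - ?P (F (G s)) 1 0 = 0" for s
      unfolding F_def using prim_rhs_node[OF j, of 1 \<alpha> R "lift u0 + prim (G s)"] N by simp
    ultimately have "((\<lambda>s. 0) has_integral (?P (G t) j 0 - ?P (G t) 1 0)) {0..t}" by simp
    then show ?thesis by (simp add: has_integral_0_eq)
  qed
  have PG: "?P (G t) \<in> H1e N l" if "0 \<le> t" for t
    by (intro H1eI prim_in_H1_edges prim_end node that)
  have PF: "?P (F g) \<in> H1e N l" for g
    unfolding F_def by (intro H1eI prim_in_H1_edges prim_end prim_rhs_node) (use N in auto)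
  have u_edges: "u t \<in> H1_edges" for t
    unfolding u_def[abs_def] by (intro H1_edges_add prim_in_H1_edges H1e_edges[OF u0])
  have uH: "u t \<in> H1e N l" if "0 \<le> t" for t
  proof (rule H1eI[OF u_edges])
    show "u t j (l j) = 0" if "j \<in> {1..N}" for j
      using H1eD(3)[OF u0 that] prim_end[OF that] by (simp add: u_def)
    show "u t j 0 = u t 1 0" if "j \<in> {1..N}" for j
      unfolding u_def node[OF \<open>0 \<le> t\<close> that] H1e_node[OF u0 that] ..
  qed
  define E where "E t = H1e_inner N l (u t) (u t)" for t
  define b where "b g h = H1e_inner N l (?P g) (?P h)" for g h
  define Lu where "Lu g = H1e_inner N l u0 (?P g)" for g
  interpret b: bounded_bilinear b unfolding b_def[abs_def] by (rule bounded_bilinear_inner_prim)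
  have Lu: "bounded_linear Lu" unfolding Lu_def[abs_def] by (rule bounded_linear_inner_prim[OF H1e_edges[OF u0]])
  have inner_u: "H1e_inner N l (u t) v = H1e_inner N l u0 v + H1e_inner N l (?P (G t)) v" if "v \<in> H1_edges" for t v
    unfolding u_def[abs_def] by (intro H1e_inner_add prim_in_H1_edges H1e_edges[OF u0] that)
  have E: "E t = H1e_inner N l u0 u0 + 2 * Lu (G t) + b (G t) (G t)" for t
  proof -
    have "E t = H1e_inner N l u0 (u t) + H1e_inner N l (?P (G t)) (u t)"
      unfolding E_def by (rule inner_u[OF u_edges])
    moreover have "H1e_inner N l u0 (u t) = H1e_inner N l u0 u0 + Lu (G t)"
      using inner_u[OF H1e_edges[OF u0], of t]
      by (simp only: Lu_def H1e_inner_commute[of "u t" u0] H1e_inner_commute[of "?P (G t)" u0])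
    moreover have "H1e_inner N l (?P (G t)) (u t) = Lu (G t) + b (G t) (G t)"
      using inner_u[OF prim_in_H1_edges, of t "G t"]
      by (simp only: Lu_def b_def H1e_inner_commute[of "u t" "?P (G t)"])
    ultimately show ?thesis by simp
  qed
  have Eder: "(E has_real_derivative 2 * H1e_inner N l (u t) (?P (F (G t)))) (at t)" if "0 < t" for t
  proof -
    have "((\<lambda>t. H1e_inner N l u0 u0 + 2 * Lu (G t) + b (G t) (G t)) has_vector_derivative
        0 + 2 * Lu (F (G t)) + (b (G t) (F (G t)) + b (F (G t)) (G t))) (at t)"
      by (intro has_vector_derivative_add has_vector_derivative_const has_vector_derivative_mult_right
          bounded_linear.has_vector_derivative[OF Lu] b.has_vector_derivative Gder[OF that])
    moreover have "b (F (G t)) (G t) = b (G t) (F (G t))"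
      unfolding b_def by (rule H1e_inner_commute)
    moreover have "H1e_inner N l (u t) (?P (F (G t))) = Lu (F (G t)) + b (G t) (F (G t))"
      unfolding inner_u[OF prim_in_H1_edges] Lu_def b_def ..
    ultimately show ?thesis
      unfolding E[abs_def] has_real_derivative_iff_has_vector_derivative by simp
  qed
  have Ec: "continuous_on {0..} E"
    unfolding E[abs_def]
    by (intro continuous_intros bounded_linear.continuous_on[OF Lu] b.continuous_on continuous_on_subset[OF Gc]) auto
  have bound: "\<bar>u t j x\<bar> \<le> R" if t: "0 \<le> t" and Et: "E t < R\<^sup>2" and jx: "j \<in> {1..N}" "x \<in> {0..l j}" for t j x
  proof -
    have "(u t j x)\<^sup>2 < R\<^sup>2" using abs_le_H1e_norm(1)[OF uH[OF t] jx] Et unfolding E_def by linarith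
    then show ?thesis using R by (metis abs_le_square_iff abs_of_nonneg less_imp_le)
  qed
  \<comment> \<open>Below the energy level \<open>R\<^sup>2\<close> the truncation is inactive.\<close>
  have ell: "elliptic_solution N l \<alpha> (u t) (?P (F (G t)))" if "0 \<le> t" "E t < R\<^sup>2" for t
    unfolding Fstate[symmetric] by (rule elliptic_solution_prim_rhs[OF uH[OF that(1)] bound[OF that]])
  have G0: "G 0 = 0" using G[of 0] by simp
  have E0: "E 0 = (H1e_norm N l u0)\<^sup>2"
    unfolding E G0 H1e_norm_square[OF u0] by (simp add: linear_simps[OF Lu] b.zero_left)
  also have "\<dots> < R\<^sup>2" using norm0 unfolding R_def by (intro power_strict_mono) auto
  finally have E0R: "E 0 < R\<^sup>2" .
  have ER: "E t < R\<^sup>2" if "0 \<le> t" for t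
  proof -
    have "E t \<le> E 0"
    proof (rule nonincreasing_below_barrier[OF Ec E0R _ that])
      fix t assume t: "0 < t" "E t < R\<^sup>2"
      have "H1e_inner N l (u t) (?P (F (G t))) = (real N / 2 - \<alpha>) * (u t 1 0)\<^sup>2"
        using t by (intro elliptic_energy_identity uH ell) auto
      also have "\<dots> \<le> 0" using \<alpha> by (intro mult_nonpos_nonneg) auto
      finally show "\<exists>y. (E has_real_derivative y) (at t) \<and> y \<le> 0" using Eder[OF t(1)] by auto
    qed
    with E0R show ?thesis by simp
  qed
  have diff: "u s j x - u t j x = ?P (G s - G t) j x" for s t j x
    by (simp add: u_def linear_simps[OF bounded_linear_prim])
  obtain C where C: "\<And>g. H1e_norm N l (?P g) \<le> C * norm g" using H1e_norm_prim_bound by blast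
  have uC: "u \<in> C_H1e N l"
    unfolding C_H1e_def
  proof (intro CollectI conjI allI impI uH)
    fix t :: real assume "0 \<le> t"
    have "(G \<longlongrightarrow> G t) (at t within {0..})"
      using continuous_on_subset[OF Gc, of "{0..}"] \<open>0 \<le> t\<close> by (auto simp: continuous_on_def)
    then have "((\<lambda>s. C * norm (G s - G t)) \<longlongrightarrow> C * norm (G t - G t)) (at t within {0..})"
      by (intro tendsto_intros)
    then have lim: "((\<lambda>s. C * norm (G s - G t)) \<longlongrightarrow> 0) (at t within {0..})" by simp
    have le: "norm (H1e_norm N l (?P (G s - G t))) \<le> C * norm (G s - G t)" for s
      using C[of "G s - G t"] H1e_norm_prim_nonneg[of "G s - G t"] by simp
    show "((\<lambda>s. H1e_norm N l (\<lambda>j x. u s j x - u t j x)) \<longlongrightarrow> 0) (at t within {0..})"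
      unfolding diff by (rule Lim_null_comparison[OF always_eventually[OF allI[OF le]] lim])
  qed
  have ex: "unique_elliptic_solution N l \<alpha> (u t) (?P (F (G t)))" if "0 \<le> t" for t
    unfolding unique_elliptic_solution_def
    using ell[OF that ER[OF that]] elliptic_solution_unique[OF uH[OF that]] by blast
  have int: "has_integral_H1e N l (\<lambda>t. ?P (F (G t))) (\<lambda>j x. u t j x - u0 j x) t" if "0 \<le> t" for t
    using has_integral_H1e_prim[OF Gint[OF that] PF PG[OF that]] by (simp add: u_def)
  show ?thesis
    unfolding BBM_solution_def
    by (intro exI[of _ u] conjI exI[of _ "\<lambda>t. ?P (F (G t))"] allI impI uC ex int)
qed

lemma continuous_on_lift_solution:
  assumes a: "a \<in> C_H1e N l"
  shows "continuous_on {0..T} (\<lambda>t. lift (a t))"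
  unfolding continuous_on_def
proof
  fix t assume t: "t \<in> {0..T}"
  have aH: "a s \<in> H1e N l" if "0 \<le> s" for s using a that by (simp add: C_H1e_def)
  have "((\<lambda>s. H1e_norm N l (\<lambda>j x. a s j x - a t j x)) \<longlongrightarrow> 0) (at t within {0..})"
    using a t by (simp add: C_H1e_def)
  then have lim: "((\<lambda>s. H1e_norm N l (\<lambda>j x. a s j x - a t j x)) \<longlongrightarrow> 0) (at t within {0..T})"
    by (rule tendsto_within_subset) auto
  have "norm (lift (a s) - lift (a t)) \<le> H1e_norm N l (\<lambda>j x. a s j x - a t j x)" if "s \<in> {0..T}" for s
  proof -
    have d: "(\<lambda>j x. a s j x - a t j x) \<in> H1e N l" using that t by (intro H1e_diff aH) auto
    show ?thesis
    proof (rule norm_lift_diff_le)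
      show "net_continuous (a s)" "net_continuous (a t)" using that t by (auto intro!: H1eD(1) aH)
      show "\<bar>a s j x - a t j x\<bar> \<le> H1e_norm N l (\<lambda>j x. a s j x - a t j x)"
        if "j \<in> {1..N}" "x \<in> {0..l j}" for j x
        by (rule abs_le_H1e_norm(2)[OF d that])
      show "0 \<le> H1e_norm N l (\<lambda>j x. a s j x - a t j x)"
        by (rule H1e_norm_nonneg[OF d])
    qed
  qed
  then have "eventually (\<lambda>s. norm (lift (a s) - lift (a t)) \<le> H1e_norm N l (\<lambda>j x. a s j x - a t j x)) (at t within {0..T})"
    by (auto simp: eventually_at_filter)
  then have "((\<lambda>s. lift (a s) - lift (a t)) \<longlongrightarrow> 0) (at t within {0..T})"
    by (rule Lim_null_comparison[OF _ lim])
  then show "((\<lambda>s. lift (a s)) \<longlongrightarrow> lift (a t)) (at t within {0..T})"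
    by (simp add: Lim_null[symmetric])
qed

text \<open>By uniqueness for the elliptic problem the time derivative of a solution is the explicit one, and
  truncation at a bound \<open>R\<close> for the solution on \<open>{0..T}\<close> leaves it unchanged.\<close>

lemma BBM_solution_integral_equation:
  assumes a: "BBM_solution N l \<alpha> u0 a" and t: "t \<in> {0..T}" and j: "j \<in> {1..N}" and x: "x \<in> {0..l j}"
    and R: "\<And>s j x. s \<in> {0..T} \<Longrightarrow> j \<in> {1..N} \<Longrightarrow> x \<in> {0..l j} \<Longrightarrow> \<bar>a s j x\<bar> \<le> R"
  shows "((\<lambda>s. apply_bcontfun (prim (rhs \<alpha> R (lift (a s)))) (j, x)) has_integral (a t j x - u0 j x)) {0..t}"
proof -
  obtain v where v: "\<And>s. 0 \<le> s \<Longrightarrow> unique_elliptic_solution N l \<alpha> (a s) (v s)"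
    "\<And>t. 0 \<le> t \<Longrightarrow> has_integral_H1e N l v (\<lambda>j x. a t j x - u0 j x) t"
    using a unfolding BBM_solution_def by blast
  have "((\<lambda>s. v s j x) has_integral (a t j x - u0 j x)) {0..t}"
    using has_integral_H1e_imp_pointwise[OF v(2) j x, of t] t by simp
  then show ?thesis
  proof (rule has_integral_eq[rotated])
    fix s assume "s \<in> {0..t}"
    then have s: "s \<in> {0..T}" using t by auto
    have aH: "a s \<in> H1e N l" using a s by (simp add: BBM_solution_def C_H1e_def)
    have "net_eq N l (v s) (\<lambda>j x. apply_bcontfun (prim (rhs \<alpha> R (lift (a s)))) (j, x))"
      using v(1)[of s] s
      by (intro elliptic_solution_unique[OF aH _ elliptic_solution_prim_rhs[OF aH R[OF s]]])
        (auto simp: unique_elliptic_solution_def)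
    then show "v s j x = apply_bcontfun (prim (rhs \<alpha> R (lift (a s)))) (j, x)"
      using j x by (simp add: net_eq_def)
  qed
qed

text \<open>Both solutions are bounded on \<open>{0..T}\<close>, so for a common truncation height they satisfy the same
  integral equation with a Lipschitz right-hand side.\<close>

theorem BBM_solution_unique:
  assumes a: "BBM_solution N l \<alpha> u0 a" and b: "BBM_solution N l \<alpha> u0 b" and "0 \<le> T"
  shows "net_eq N l (a T) (b T)"
proof -
  have ab: "a \<in> C_H1e N l" "b \<in> C_H1e N l" using a b by (auto simp: BBM_solution_def)
  note ac = continuous_on_lift_solution[OF ab(1), of T] and bc = continuous_on_lift_solution[OF ab(2), of T]
  have cont: "net_continuous (a s)" "net_continuous (b s)" if "0 \<le> s" for s
    using ab that by (auto simp: C_H1e_def intro!: H1eD(1))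
  have "bounded ((\<lambda>t. lift (a t)) ` {0..T} \<union> (\<lambda>t. lift (b t)) ` {0..T})"
    by (intro bounded_Un[THEN iffD2] conjI compact_imp_bounded compact_continuous_image ac bc) auto
  then obtain R where R: "\<And>t. t \<in> {0..T} \<Longrightarrow> norm (lift (a t)) \<le> R" "\<And>t. t \<in> {0..T} \<Longrightarrow> norm (lift (b t)) \<le> R"
    unfolding bounded_iff by blast
  have "0 \<le> R" using order_trans[OF norm_ge_zero R(1)[of 0]] \<open>0 \<le> T\<close> by simp
  have bnd: "\<bar>a s j x\<bar> \<le> R" "\<bar>b s j x\<bar> \<le> R" if "s \<in> {0..T}" "j \<in> {1..N}" "x \<in> {0..l j}" for s j x
    using abs_le_norm_state[of "lift (a s)" "(j, x)"] abs_le_norm_state[of "lift (b s)" "(j, x)"]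
      R[OF that(1)] that cont[of s] by auto
  obtain K where K: "K > 0" "\<And>u v. norm (rhs \<alpha> R u - rhs \<alpha> R v) \<le> K * norm (u - v)"
    using rhs_Lipschitz[OF \<open>0 \<le> R\<close>] by blast
  obtain B where B: "B > 0" "\<And>G. norm (prim G) \<le> norm G * B"
    using bounded_linear.pos_bounded[OF bounded_linear_prim] by blast
  let ?V = "\<lambda>f j x. apply_bcontfun (prim (rhs \<alpha> R f)) (j, x)"
  have V: "\<bar>?V f j x - ?V g j x\<bar> \<le> K * B * norm (f - g)" for f g j x
  proof -
    have "\<bar>?V f j x - ?V g j x\<bar> = \<bar>apply_bcontfun (prim (rhs \<alpha> R f - rhs \<alpha> R g)) (j, x)\<bar>"
      by (simp add: linear_simps[OF bounded_linear_prim])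
    also have "\<dots> \<le> norm (rhs \<alpha> R f - rhs \<alpha> R g) * B"
      using abs_le_norm_state B(2) order_trans by blast
    also have "\<dots> \<le> (K * norm (f - g)) * B" using K B by (intro mult_right_mono) auto
    finally show ?thesis by (simp add: mult_ac)
  qed
  define d where "d t = norm (lift (a t) - lift (b t))" for t
  have dc: "continuous_on {0..T} d" unfolding d_def[abs_def] by (intro continuous_intros ac bc)
  have "d T = 0"
  proof (rule Gronwall_zero[of "K * B" T d])
    fix t assume t: "t \<in> {0..T}"
    have dt: "continuous_on {0..t} d" using dc by (rule continuous_on_subset) (use t in auto)
    have i: "(\<lambda>s. K * B * d s) integrable_on {0..t}"
      by (intro integrable_continuous_real continuous_intros dt)
    have "norm (lift (a t) - lift (b t)) \<le> integral {0..t} (\<lambda>s. K * B * d s)"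
    proof (rule norm_lift_diff_le)
      fix j x assume jx: "j \<in> {1..N}" "x \<in> {0..l j}"
      have "((\<lambda>s. ?V (lift (a s)) j x - ?V (lift (b s)) j x) has_integral (a t j x - u0 j x) - (b t j x - u0 j x)) {0..t}"
        by (intro has_integral_diff BBM_solution_integral_equation[OF a t jx] BBM_solution_integral_equation[OF b t jx] bnd)
      then have h: "((\<lambda>s. ?V (lift (a s)) j x - ?V (lift (b s)) j x) has_integral a t j x - b t j x) {0..t}" by simp
      have "norm (integral {0..t} (\<lambda>s. ?V (lift (a s)) j x - ?V (lift (b s)) j x)) \<le> integral {0..t} (\<lambda>s. K * B * d s)"
        using h i V unfolding d_def by (intro integral_norm_bound_integral) (auto simp: has_integral_iff)
      then show "\<bar>a t j x - b t j x\<bar> \<le> integral {0..t} (\<lambda>s. K * B * d s)"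
        unfolding integral_unique[OF h] by simp
    next
      show "0 \<le> integral {0..t} (\<lambda>s. K * B * d s)"
        using K B by (intro integral_nonneg i) (auto simp: d_def)
    qed (use t cont in auto)
    then show "d t \<le> K * B * integral {0..t} d" by (simp add: d_def[abs_def])
  qed (use K B dc \<open>0 \<le> T\<close> in \<open>auto simp: d_def\<close>)
  then have "lift (a T) = lift (b T)" by (simp add: d_def)
  then show ?thesis
    unfolding net_eq_def using cont[OF \<open>0 \<le> T\<close>] by (metis lift_eq)
qed

end

theorem proposition3p1:
  fixes N :: nat and l :: "nat \<Rightarrow> real" and \<alpha> :: real and u0 :: net_fun
  assumes "N \<ge> 1" and "\<And>j. j \<in> {1..N} \<Longrightarrow> l j > 0" and "\<alpha> > real N / 2"
    and "u0 \<in> H1e N l"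
  shows "\<exists>u. BBM_solution N l \<alpha> u0 u \<and>
           (\<forall>w. BBM_solution N l \<alpha> u0 w \<longrightarrow> (\<forall>t\<ge>0. net_eq N l (w t) (u t)))"
proof -
  interpret star_network N l using assms(1,2) by unfold_locales
  obtain u where "BBM_solution N l \<alpha> u0 u"
    using BBM_solution_exists[of \<alpha> u0] assms(3,4) by auto
  then show ?thesis using BBM_solution_unique by blast
qed

end
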